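(* For every $\beta\in(0,1)$ there exist functions $\omega:\mathbb R\to(0,1]$ such that $\log(1/\omega)$ is absolutely continuous on every compact interval, $\log(1/\omega)\in L^1\bigl(\mathbb R,\tfrac{dx}{1+x^2}\bigr)$, and the $\beta$-Hölder constants $\kappa_j$ of $\log(1/\omega)$ on the intervals $J_j$ satisfy $$2^{-|j|}\kappa_j^{1/(1-\beta)}\asymp 1,\qquad j\in\mathbb Z,$$ but $\omega$ is not a Beurling--Malliavin majorant.
   Context: Define intervals $J_0=[-2,2)$ and, for $j\in\mathbb N=\{1,2,\dots\}$, $J_j=[2^j,2^{j+1})$ and $J_{-j}=[-2^{j+1},-2^j)$. For $j\in\mathbb Z$, $\kappa_j$ denotes the (smallest) constant such that $|\Omega(x)-\Omega(y)|\le\kappa_j|x-y|^\beta$ for all $x,y\in J_j$, where $\Omega=\log(1/\omega)$. The notation $X_j\asymp 1$ means that there are constants $0<\mathcal C_1\le\mathcal C_2<\infty$ independent of $j$ with $\mathcal C_1\le X_j\le\mathcal C_2$ for all $j$. For $f\in L^2(\mathbb R)$, $\mathrm{spec}(f)$ denotes the support of the Fourier transform of $f$. A bounded nonnegative function $\omega$ on $\mathbb R$ is called a Beurling--Malliavin majorant if for every $\sigma>0$ there exists a nonzero (i.e. not almost everywhere zero) function $f\in L^2(\mathbb R)$ such that $|f|\le\omega$ and $\mathrm{spec}(f)\subset[0,\sigma]$. *)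

theory Defs
  imports "HOL-Analysis.Analysis"
begin

definition neg_log :: "(real \<Rightarrow> real) \<Rightarrow> real \<Rightarrow> real" where
  "neg_log \<omega> x = ln (1 / \<omega> x)"

definition J :: "int \<Rightarrow> real set" where
  "J j = (if j = 0 then {-2..<2}
          else if j > 0 then {2 powi j..<2 powi (j + 1)}
          else {- (2 powi (- j + 1))..<- (2 powi (- j))})"

definition holder_bound :: "real \<Rightarrow> (real \<Rightarrow> real) \<Rightarrow> real set \<Rightarrow> real \<Rightarrow> bool" where
  "holder_bound \<beta> f S K \<longleftrightarrow> (\<forall>x\<in>S. \<forall>y\<in>S. \<bar>f x - f y\<bar> \<le> K * \<bar>x - y\<bar> powr \<beta>)"

(* Stated as a relation, so that having a smallest constant includes being Hoelder at all. *)
definition least_holder_const :: "real \<Rightarrow> (real \<Rightarrow> real) \<Rightarrow> real set \<Rightarrow> real \<Rightarrow> bool" where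
  "least_holder_const \<beta> f S K \<longleftrightarrow>
     holder_bound \<beta> f S K \<and> (\<forall>K'. holder_bound \<beta> f S K' \<longrightarrow> K \<le> K')"

definition asymp_one :: "(int \<Rightarrow> real) \<Rightarrow> bool" where
  "asymp_one X \<longleftrightarrow> (\<exists>C1 C2. 0 < C1 \<and> C1 \<le> C2 \<and> (\<forall>j. C1 \<le> X j \<and> X j \<le> C2))"

(* Absolute continuity of a function; the library constant absolutely_continuous
   is the relation between measures. *)
definition abs_continuous_on_interval :: "(real \<Rightarrow> real) \<Rightarrow> real \<Rightarrow> real \<Rightarrow> bool" where
  "abs_continuous_on_interval f a b \<longleftrightarrow>
     (\<forall>\<epsilon>>0. \<exists>\<delta>>0. \<forall>(n::nat) u v.
        (\<forall>i<n. a \<le> u i \<and> u i \<le> v i \<and> v i \<le> b) \<and>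
        disjoint_family_on (\<lambda>i. {u i<..<v i}) {..<n} \<and>
        (\<Sum>i<n. v i - u i) < \<delta>
        \<longrightarrow> (\<Sum>i<n. \<bar>f (v i) - f (u i)\<bar>) < \<epsilon>)"

definition L2_fun :: "(real \<Rightarrow> complex) \<Rightarrow> bool" where
  "L2_fun f \<longleftrightarrow> f \<in> borel_measurable lborel \<and> integrable lborel (\<lambda>x. (cmod (f x))\<^sup>2)"

definition truncated_fourier :: "(real \<Rightarrow> complex) \<Rightarrow> real \<Rightarrow> real \<Rightarrow> complex" where
  "truncated_fourier f R \<xi> = (LINT x:{-R..R}|lborel. exp (- \<i> * of_real (x * \<xi>)) * f x)"

(* F is the Fourier transform of the square-integrable function f: the limit in L^2, as R tends
   to infinity, of the Fourier integrals over [-R, R]. *)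
definition has_L2_fourier_transform :: "(real \<Rightarrow> complex) \<Rightarrow> (real \<Rightarrow> complex) \<Rightarrow> bool" where
  "has_L2_fourier_transform f F \<longleftrightarrow>
     L2_fun f \<and> L2_fun F \<and>
     ((\<lambda>R. \<integral>\<^sup>+ \<xi>. ennreal ((cmod (truncated_fourier f R \<xi> - F \<xi>))\<^sup>2) \<partial>lborel) \<longlongrightarrow> 0) at_top"

(* Support of F as an element of L^2, insensitive to changes of F on null sets. *)
definition ess_support :: "(real \<Rightarrow> complex) \<Rightarrow> real set" where
  "ess_support F =
     {\<xi>. \<forall>U. open U \<and> \<xi> \<in> U \<longrightarrow> \<not> (AE x in lborel. x \<in> U \<longrightarrow> F x = 0)}"

(* By Plancherel's theorem every square-integrable f has a Fourier transform F, unique up to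
   null sets, so the intersection is over representatives with one and the same support. *)
definition spec :: "(real \<Rightarrow> complex) \<Rightarrow> real set" where
  "spec f = (\<Inter>F\<in>{F. has_L2_fourier_transform f F}. ess_support F)"

definition Beurling_Malliavin_majorant :: "(real \<Rightarrow> real) \<Rightarrow> bool" where
  "Beurling_Malliavin_majorant \<omega> \<longleftrightarrow>
     bounded (range \<omega>) \<and> (\<forall>x. 0 \<le> \<omega> x) \<and>
     (\<forall>\<sigma>>0. \<exists>f. L2_fun f \<and> \<not> (AE x in lborel. f x = 0) \<and>
        (AE x in lborel. cmod (f x) \<le> \<omega> x) \<and> spec f \<subseteq> {0..\<sigma>})"

end

theory Submission
  imports Defs
    "HOL-Complex_Analysis.Complex_Analysis"
    "HOL-Probability.Characteristic_Functions"
    "HOL-Real_Asymp.Real_Asymp"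
begin

text \<open>
The majorant is \<open>\<omega> = exp (- \<Omega>)\<close> for an even function \<open>\<Omega>\<close> that is a train of narrow spikes. The dyadic
block \<open>[2^n, 2^(n+1)]\<close> and its mirror image carry \<open>n + 1\<close> equally spaced spikes
\<open>K * max 0 (r^\<beta> - |x - c|^\<beta>)\<close> with \<open>K = 2^(n*(1-\<beta>))\<close> and \<open>r = 2^(n-1) * (n+1)^(-b)\<close>. Their supports
are disjoint, so the \<open>\<beta>\<close>-Hoelder constant on the block is exactly \<open>K\<close>, however many spikes there are
(lemma \<open>\<Omega>_least_holder_const\<close>). The heights are of the order \<open>2^n * (n+1)^(-b*\<beta>)\<close>, and the block
contributes at most a constant times \<open>(n+1)^(1-b*(1+\<beta>))\<close> to the integral of \<open>\<Omega> / (1 + x^2)\<close>, which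
therefore converges if \<open>b * (1+\<beta>) > 2\<close> (lemma \<open>\<Omega>_integrable\<close>).

The spikes occupy a vanishing proportion of the block, and yet they push down a function \<open>f\<close> with
spectrum in \<open>[0, 1]\<close> on the whole block. Such an \<open>f\<close> gives rise to an entire function \<open>g\<close> of exponential
type, bounded in the upper half-plane and bounded by \<open>\<omega>\<close> on the real line (lemma
\<open>bandlimited_entire_extension\<close>). Near the centre of a spike \<open>g\<close> is at most \<open>exp (- H)\<close> with \<open>H\<close> of the
order \<open>2^n * (n+1)^(-b*\<beta>)\<close>. A segment of length comparable to \<open>r\<close> is not a polar set in the plane: seen from
distance \<open>s\<close>, inside a disc of radius comparable to \<open>s\<close>, its harmonic measure is still of the order
\<open>1 / ln (s/r)\<close>. So up to the distance \<open>s = 2^n / (2*(n+1))\<close>, which is half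
the spacing, the exponent drops from \<open>H\<close> to \<open>H / ln (s/r)\<close>, a loss by a factor of order \<open>ln n\<close>
(lemma \<open>decay_near_dip\<close>). If \<open>b * \<beta> < 1\<close>, the remaining exponent exceeds any multiple of \<open>2^n / (n+1)\<close>
for large \<open>n\<close> and absorbs the factor \<open>exp (O(s))\<close> by which \<open>g\<close> may grow in the lower half-plane. Hence
\<open>|g| \<le> C * exp (- 2^n / (n+1))\<close> on the entire block (lemma \<open>decay_on_dyadic_blocks\<close>). Seen from a fixed
point of the upper half-plane, the block has harmonic measure of order \<open>2^(-n)\<close>, and the harmonic series
diverges, so \<open>g\<close> vanishes (lemma \<open>eq_0_of_log_integral_diverges\<close>), and with it \<open>f\<close>.

The two conditions on \<open>b\<close> are compatible because \<open>2 / (1+\<beta>) < 1 / \<beta>\<close>, which says that \<open>\<beta> < 1\<close>.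
\<close>

section \<open>Square-integrable functions with spectrum in [0, 1] as entire functions\<close>

text \<open>The complement of the support is a union of open sets on each of which the function vanishes almost
everywhere; by the Lindeloef property countably many of them suffice.\<close>

lemma AE_zero_off_ess_support:
  "AE x in lborel. x \<notin> ess_support F \<longrightarrow> F x = 0"
proof -
  define \<U> where "\<U> = {U. open U \<and> (AE x in lborel. x \<in> U \<longrightarrow> F x = 0)}"
  obtain \<V> where \<V>: "\<V> \<subseteq> \<U>" "countable \<V>" "\<Union>\<V> = \<Union>\<U>"
    using Lindelof[of \<U>] by (auto simp: \<U>_def)
  have "AE x in lborel. \<forall>U\<in>\<V>. x \<in> U \<longrightarrow> F x = 0"
    using \<V> by (subst AE_ball_countable) (auto simp: \<U>_def)
  then show ?thesis
  proof eventually_elim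
    case (elim x)
    show ?case
    proof
      assume "x \<notin> ess_support F"
      then have "x \<in> \<Union>\<U>" by (auto simp: ess_support_def \<U>_def)
      then show "F x = 0" using elim \<V>(3) by (metis UnionE)
    qed
  qed
qed

lemma ess_support_cong_AE:
  assumes "AE x in lborel. F x = G x"
  shows "ess_support F = ess_support G"
proof -
  have "(AE x in lborel. x \<in> U \<longrightarrow> F x = 0) \<longleftrightarrow> (AE x in lborel. x \<in> U \<longrightarrow> G x = 0)" for U
  proof
    assume "AE x in lborel. x \<in> U \<longrightarrow> F x = 0"
    with assms show "AE x in lborel. x \<in> U \<longrightarrow> G x = 0" by eventually_elim auto
  next
    assume "AE x in lborel. x \<in> U \<longrightarrow> G x = 0"
    with assms show "AE x in lborel. x \<in> U \<longrightarrow> F x = 0" by eventually_elim auto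
  qed
  then show ?thesis by (simp add: ess_support_def)
qed

lemma truncated_fourier_measurable [measurable]:
  assumes [measurable]: "f \<in> borel_measurable borel"
  shows "truncated_fourier f R \<in> borel_measurable borel"
  unfolding truncated_fourier_def set_lebesgue_integral_def by measurable

lemma has_L2_fourier_transform_unique:
  assumes "has_L2_fourier_transform f F" "has_L2_fourier_transform f G"
  shows "AE x in lborel. F x = G x"
proof -
  have meas [measurable]: "f \<in> borel_measurable borel" "F \<in> borel_measurable borel" "G \<in> borel_measurable borel"
    using assms by (auto simp: has_L2_fourier_transform_def L2_fun_def)
  define E where "E = (\<lambda>H R. \<integral>\<^sup>+ \<xi>. ennreal ((cmod (truncated_fourier f R \<xi> - H \<xi>))\<^sup>2) \<partial>lborel)"
  have "((\<lambda>R. 2 * (E F R + E G R)) \<longlongrightarrow> 2 * (0 + 0)) at_top"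
  proof (rule ennreal_tendsto_cmult)
    show "((\<lambda>R. E F R + E G R) \<longlongrightarrow> 0 + 0) at_top"
      using assms unfolding has_L2_fourier_transform_def E_def by (intro tendsto_add) auto
  qed simp
  moreover have "(\<integral>\<^sup>+ \<xi>. ennreal ((cmod (F \<xi> - G \<xi>))\<^sup>2) \<partial>lborel) \<le> 2 * (E F R + E G R)" for R
  proof -
    have "(cmod (F \<xi> - G \<xi>))\<^sup>2 \<le> 2 * ((cmod (truncated_fourier f R \<xi> - F \<xi>))\<^sup>2 + (cmod (truncated_fourier f R \<xi> - G \<xi>))\<^sup>2)" for \<xi>
    proof -
      have "cmod (F \<xi> - G \<xi>) \<le> cmod (truncated_fourier f R \<xi> - F \<xi>) + cmod (truncated_fourier f R \<xi> - G \<xi>)"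
        using norm_triangle_ineq4[of "truncated_fourier f R \<xi> - G \<xi>" "truncated_fourier f R \<xi> - F \<xi>"]
        by (simp add: add.commute)
      then have "(cmod (F \<xi> - G \<xi>))\<^sup>2 \<le> (cmod (truncated_fourier f R \<xi> - F \<xi>) + cmod (truncated_fourier f R \<xi> - G \<xi>))\<^sup>2"
        by (intro power_mono) auto
      also have "\<dots> \<le> 2 * ((cmod (truncated_fourier f R \<xi> - F \<xi>))\<^sup>2 + (cmod (truncated_fourier f R \<xi> - G \<xi>))\<^sup>2)"
        using sum_squares_bound[of "cmod (truncated_fourier f R \<xi> - F \<xi>)" "cmod (truncated_fourier f R \<xi> - G \<xi>)"]
        by (simp add: power2_sum algebra_simps)
      finally show ?thesis .
    qed
    then have "ennreal ((cmod (F \<xi> - G \<xi>))\<^sup>2) \<le> ennreal (2 * ((cmod (truncated_fourier f R \<xi> - F \<xi>))\<^sup>2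
        + (cmod (truncated_fourier f R \<xi> - G \<xi>))\<^sup>2))" for \<xi>
      by (rule ennreal_leI)
    then have "ennreal ((cmod (F \<xi> - G \<xi>))\<^sup>2) \<le> 2 * (ennreal ((cmod (truncated_fourier f R \<xi> - F \<xi>))\<^sup>2)
        + ennreal ((cmod (truncated_fourier f R \<xi> - G \<xi>))\<^sup>2))" for \<xi>
      by (subst (asm) ennreal_mult') (simp_all add: ennreal_plus)
    then have "(\<integral>\<^sup>+ \<xi>. ennreal ((cmod (F \<xi> - G \<xi>))\<^sup>2) \<partial>lborel) \<le>
       (\<integral>\<^sup>+ \<xi>. 2 * (ennreal ((cmod (truncated_fourier f R \<xi> - F \<xi>))\<^sup>2) + ennreal ((cmod (truncated_fourier f R \<xi> - G \<xi>))\<^sup>2)) \<partial>lborel)"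
      by (intro nn_integral_mono)
    also have "\<dots> = 2 * (E F R + E G R)"
      unfolding E_def by (simp add: nn_integral_cmult nn_integral_add)
    finally show ?thesis .
  qed
  ultimately have "(\<integral>\<^sup>+ \<xi>. ennreal ((cmod (F \<xi> - G \<xi>))\<^sup>2) \<partial>lborel) \<le> 2 * (0 + 0)"
    by (intro tendsto_lowerbound) auto
  then have "(\<integral>\<^sup>+ \<xi>. ennreal ((cmod (F \<xi> - G \<xi>))\<^sup>2) \<partial>lborel) = 0" by simp
  then show ?thesis by (subst (asm) nn_integral_0_iff_AE) (auto elim!: eventually_mono)
qed

text \<open>An inclusion of the spectrum in a proper subset of the line forces the intersection that defines the
spectrum to be over a nonempty family; its members share one support because Fourier transforms are
unique up to null sets.\<close>

lemma spec_subsetE: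
  assumes "spec f \<subseteq> S" "S \<noteq> UNIV"
  obtains F where "has_L2_fourier_transform f F" "AE \<xi> in lborel. \<xi> \<notin> S \<longrightarrow> F \<xi> = 0"
proof -
  obtain F where F: "has_L2_fourier_transform f F"
    using assms by (auto simp: spec_def)
  have "ess_support G = ess_support F" if "has_L2_fourier_transform f G" for G
    by (intro ess_support_cong_AE has_L2_fourier_transform_unique[OF that F])
  then have "ess_support ` {G. has_L2_fourier_transform f G} = {ess_support F}" using F by blast
  then have "spec f = ess_support F" by (simp add: spec_def)
  then have "AE \<xi> in lborel. \<xi> \<notin> S \<longrightarrow> F \<xi> = 0"
    using AE_zero_off_ess_support[of F] assms by (auto elim!: eventually_mono)
  then show ?thesis using that F by blast
qed

lemma has_L2_fourier_transform_cong_AE: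
  assumes "has_L2_fourier_transform f F"
    and f: "AE x in lborel. f x = f' x" "f' \<in> borel_measurable borel"
    and F: "AE x in lborel. F x = F' x" "F' \<in> borel_measurable borel"
  shows "has_L2_fourier_transform f' F'"
proof -
  have [measurable]: "f \<in> borel_measurable borel" "F \<in> borel_measurable borel"
    "f' \<in> borel_measurable borel" "F' \<in> borel_measurable borel"
    using assms by (auto simp: has_L2_fourier_transform_def L2_fun_def)
  have L: "L2_fun h'" if "L2_fun h" "AE x in lborel. h x = h' x" "h' \<in> borel_measurable borel" for h h'
  proof -
    have "integrable lborel (\<lambda>x. (cmod (h x))\<^sup>2) \<longleftrightarrow> integrable lborel (\<lambda>x. (cmod (h' x))\<^sup>2)"
    proof (rule integrable_cong_AE)
      show "AE x in lborel. (cmod (h x))\<^sup>2 = (cmod (h' x))\<^sup>2" using that(2) by eventually_elim simp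
    qed (use that in \<open>auto simp: L2_fun_def\<close>)
    then show ?thesis using that by (simp add: L2_fun_def)
  qed
  have T: "truncated_fourier f' R = truncated_fourier f R" for R
    unfolding truncated_fourier_def set_lebesgue_integral_def
  proof (intro ext integral_cong_AE)
    fix \<xi>
    show "AE x in lborel. indicat_real {- R..R} x *\<^sub>R (exp (- \<i> * of_real (x * \<xi>)) * f' x) =
       indicat_real {- R..R} x *\<^sub>R (exp (- \<i> * of_real (x * \<xi>)) * f x)"
      using f(1) by eventually_elim simp
  qed measurable
  have "(\<integral>\<^sup>+ \<xi>. ennreal ((cmod (truncated_fourier f R \<xi> - F' \<xi>))\<^sup>2) \<partial>lborel)
      = (\<integral>\<^sup>+ \<xi>. ennreal ((cmod (truncated_fourier f R \<xi> - F \<xi>))\<^sup>2) \<partial>lborel)" for R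
  proof (rule nn_integral_cong_AE)
    show "AE \<xi> in lborel. ennreal ((cmod (truncated_fourier f R \<xi> - F' \<xi>))\<^sup>2)
        = ennreal ((cmod (truncated_fourier f R \<xi> - F \<xi>))\<^sup>2)"
      using F(1) by eventually_elim simp
  qed
  moreover have "L2_fun f'" "L2_fun F'"
    using assms by (auto intro: L[of f] L[of F] simp: has_L2_fourier_transform_def)
  ultimately show ?thesis using assms(1) by (simp add: has_L2_fourier_transform_def T)
qed

lemma integrable_pair_mult:
  fixes a b :: "real \<Rightarrow> complex"
  assumes a: "integrable lborel a" and b: "integrable lborel b"
  shows "integrable (lborel \<Otimes>\<^sub>M lborel) (\<lambda>(x, y). a x * b y)"
proof (rule lborel_pair.Fubini_integrable)
  have [measurable]: "a \<in> borel_measurable borel" "b \<in> borel_measurable borel"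
    using a b by auto
  show "(\<lambda>(x, y). a x * b y) \<in> borel_measurable (lborel \<Otimes>\<^sub>M lborel)" by measurable
  show "integrable lborel (\<lambda>x. \<integral>y. norm (case (x, y) of (x, y) \<Rightarrow> a x * b y) \<partial>lborel)"
    using a by (simp add: norm_mult)
  show "AE x in lborel. integrable lborel (\<lambda>y. case (x, y) of (x, y) \<Rightarrow> a x * b y)"
    using b by simp
qed

text \<open>The characteristic function of the standard normal distribution after the substitution \<open>u = e * \<xi>\<close>.\<close>

lemma fourier_gaussian:
  fixes e x t :: real
  assumes "0 < e"
  shows "integrable lborel (\<lambda>\<xi>. exp (- \<i> * of_real (t * \<xi>)) * exp (\<i> * of_real (x * \<xi>) - of_real (e\<^sup>2 * \<xi>\<^sup>2 / 2)))" (is "integrable lborel ?h")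
    and "(LINT \<xi>|lborel. exp (- \<i> * of_real (t * \<xi>)) * exp (\<i> * of_real (x * \<xi>) - of_real (e\<^sup>2 * \<xi>\<^sup>2 / 2)))
      = of_real (2 * pi * normal_density x e t)"
proof -
  define s where "s = (x - t) / e"
  have eq: "?h \<xi> = of_real (sqrt (2 * pi)) * (std_normal_density (0 + e * \<xi>) *\<^sub>R iexp (s * (0 + e * \<xi>)))" for \<xi>
  proof -
    have "?h \<xi> = exp (of_real (- (e\<^sup>2 * \<xi>\<^sup>2 / 2)) + \<i> * of_real ((x - t) * \<xi>))"
      by (simp add: exp_add[symmetric] algebra_simps)
    also have "(x - t) * \<xi> = s * (0 + e * \<xi>)" using assms by (simp add: s_def)
    finally have "?h \<xi> = exp (of_real (- (e\<^sup>2 * \<xi>\<^sup>2 / 2))) * iexp (s * (0 + e * \<xi>))"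
      by (simp only: exp_add)
    moreover have "sqrt (2 * pi) * std_normal_density (0 + e * \<xi>) = exp (- (e\<^sup>2 * \<xi>\<^sup>2 / 2))"
      by (simp add: std_normal_density_def power_mult_distrib)
    then have "of_real (sqrt (2 * pi)) * of_real (std_normal_density (0 + e * \<xi>)) = (exp (of_real (- (e\<^sup>2 * \<xi>\<^sup>2 / 2))) :: complex)"
      by (metis exp_of_real of_real_mult)
    ultimately show ?thesis by (simp add: scaleR_conv_of_real mult.assoc[symmetric])
  qed
  have int: "integrable lborel (\<lambda>u. std_normal_density u *\<^sub>R iexp (s * u))"
  proof (rule Bochner_Integration.integrable_bound)
    show "integrable lborel std_normal_density" by simp
  qed auto
  have val: "(LINT u|lborel. std_normal_density u *\<^sub>R iexp (s * u)) = of_real (exp (- s\<^sup>2 / 2))"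
  proof -
    have "char std_normal_distribution s = (LINT u|lborel. std_normal_density u *\<^sub>R iexp (s * u))"
      unfolding char_def by (subst integral_density) (auto simp: normal_density_nonneg)
    then show ?thesis by (simp add: char_std_normal_distribution)
  qed
  show "integrable lborel ?h" unfolding eq
    using assms by (intro integrable_mult_right lborel_integrable_real_affine[OF int]) auto
  have "(LINT \<xi>|lborel. ?h \<xi>) = of_real (sqrt (2 * pi)) * (LINT \<xi>|lborel. std_normal_density (0 + e * \<xi>) *\<^sub>R iexp (s * (0 + e * \<xi>)))"
    unfolding eq by (rule integral_mult_right_zero)
  also have "(LINT \<xi>|lborel. std_normal_density (0 + e * \<xi>) *\<^sub>R iexp (s * (0 + e * \<xi>))) = of_real (exp (- s\<^sup>2 / 2) / e)"
    using lborel_integral_real_affine[of e "\<lambda>u. std_normal_density u *\<^sub>R iexp (s * u)" 0] assms val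
    by (simp add: scaleR_conv_of_real field_simps)
  also have "of_real (sqrt (2 * pi)) * of_real (exp (- s\<^sup>2 / 2) / e) = (of_real (2 * pi * normal_density x e t) :: complex)"
  proof -
    have "exp (- s\<^sup>2 / 2) = exp (- (t - x)\<^sup>2 / (2 * e\<^sup>2))"
      using assms by (simp add: s_def power_divide power2_commute)
    moreover have "sqrt (2 * pi) / e = 2 * pi / sqrt (2 * pi * e\<^sup>2)"
      using assms by (simp add: real_sqrt_mult field_simps)
    moreover have "2 * pi * normal_density x e t = (2 * pi / sqrt (2 * pi * e\<^sup>2)) * exp (- (t - x)\<^sup>2 / (2 * e\<^sup>2))"
      by (simp add: normal_density_def)
    ultimately have "2 * pi * normal_density x e t = sqrt (2 * pi) / e * exp (- s\<^sup>2 / 2)" by simp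
    then have "sqrt (2 * pi) * (exp (- s\<^sup>2 / 2) / e) = 2 * pi * normal_density x e t" by simp
    then show ?thesis by (simp only: of_real_mult[symmetric])
  qed
  finally show "(LINT \<xi>|lborel. ?h \<xi>) = of_real (2 * pi * normal_density x e t)" .
qed

text \<open>This replaces the inversion formula. The identity \<open>\<integral> F * \<phi> = \<integral> f * \<phi>^\<close> passes from the truncations of
\<open>f\<close>, for which it is Fubini's theorem, to \<open>f\<close> itself: on the left because the truncated transforms
converge to \<open>F\<close> in the mean (Cauchy-Schwarz), on the right by dominated convergence. For
\<open>\<phi> \<xi> = exp (i*x*\<xi> - e^2*\<xi>^2/2)\<close> the right-hand side is an average of \<open>f\<close> at scale \<open>e\<close> around \<open>x\<close>.\<close>

lemma gaussian_regularization:
  fixes x e :: real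
  assumes FT: "has_L2_fourier_transform f F" and f1: "\<And>x. cmod (f x) \<le> 1" and e: "0 < e"
  shows "(LINT \<xi>|lborel. F \<xi> * exp (\<i> * of_real (x * \<xi>) - of_real (e\<^sup>2 * \<xi>\<^sup>2 / 2)))
    = of_real (2 * pi) * (LINT s|lborel. std_normal_density s *\<^sub>R f (x + e * s))"
proof -
  have [measurable]: "f \<in> borel_measurable borel" "F \<in> borel_measurable borel"
    using FT by (auto simp: has_L2_fourier_transform_def L2_fun_def)
  define \<phi> :: "real \<Rightarrow> complex" where "\<phi> = (\<lambda>\<xi>. exp (\<i> * of_real (x * \<xi>) - of_real (e\<^sup>2 * \<xi>\<^sup>2 / 2)))"
  have [measurable]: "\<phi> \<in> borel_measurable borel" unfolding \<phi>_def by measurable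
  have int\<phi>: "integrable lborel \<phi>" using fourier_gaussian(1)[OF e, of 0 x] by (simp add: \<phi>_def)
  have \<phi>1: "cmod (\<phi> \<xi>) \<le> 1" for \<xi> by (simp add: \<phi>_def norm_exp_eq_Re)
  have int\<phi>2: "integrable lborel (\<lambda>\<xi>. (cmod (\<phi> \<xi>))\<^sup>2)"
  proof (rule Bochner_Integration.integrable_bound[OF int\<phi>])
    show "AE \<xi> in lborel. norm ((cmod (\<phi> \<xi>))\<^sup>2) \<le> norm (\<phi> \<xi>)"
      using \<phi>1 by (auto simp: power2_eq_square intro!: mult_left_le)
  qed measurable
  have intF\<phi>: "integrable lborel (\<lambda>\<xi>. F \<xi> * \<phi> \<xi>)"
  proof (rule Bochner_Integration.integrable_bound)
    show "integrable lborel (\<lambda>\<xi>. (cmod (F \<xi>))\<^sup>2 + (cmod (\<phi> \<xi>))\<^sup>2)"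
      using int\<phi>2 FT by (auto simp: has_L2_fourier_transform_def L2_fun_def)
    show "AE \<xi> in lborel. norm (F \<xi> * \<phi> \<xi>) \<le> norm ((cmod (F \<xi>))\<^sup>2 + (cmod (\<phi> \<xi>))\<^sup>2)"
    proof (rule AE_I2)
      fix \<xi>
      have "2 * (cmod (F \<xi>) * cmod (\<phi> \<xi>)) \<le> (cmod (F \<xi>))\<^sup>2 + (cmod (\<phi> \<xi>))\<^sup>2"
        using sum_squares_bound[of "cmod (F \<xi>)" "cmod (\<phi> \<xi>)"] by (simp add: mult.assoc)
      moreover have "0 \<le> cmod (F \<xi>) * cmod (\<phi> \<xi>)" by simp
      ultimately show "norm (F \<xi> * \<phi> \<xi>) \<le> norm ((cmod (F \<xi>))\<^sup>2 + (cmod (\<phi> \<xi>))\<^sup>2)"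
        unfolding norm_mult real_norm_def by linarith
    qed
  qed measurable
  define T where "T = truncated_fourier f"
  have [measurable]: "T R \<in> borel_measurable borel" for R unfolding T_def by measurable
  define A where "A = (\<lambda>R. LINT \<xi>|lborel. T R \<xi> * \<phi> \<xi>)"
  define nd where "nd = normal_density x e"
  have [measurable]: "nd \<in> borel_measurable borel" unfolding nd_def by measurable
  define fR where "fR = (\<lambda>R t. indicat_real {-R..R} t *\<^sub>R f t)"
  have [measurable]: "fR R \<in> borel_measurable borel" for R unfolding fR_def by measurable
  have A: "integrable lborel (\<lambda>\<xi>. T R \<xi> * \<phi> \<xi>) \<and> A R = (LINT t|lborel. fR R t * of_real (2 * pi * nd t))" for R
  proof -
    have intfR: "integrable lborel (fR R)"
    proof (rule Bochner_Integration.integrable_bound)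
      show "integrable lborel (indicat_real {-R..R})"
        by (intro integrable_real_indicator) (auto simp: emeasure_lborel_Icc_eq)
      show "AE t in lborel. norm (fR R t) \<le> norm (indicat_real {-R..R} t)"
        using f1 by (auto simp: fR_def mult_left_le)
    qed measurable
    define K where "K = (\<lambda>t \<xi>. fR R t * (exp (- \<i> * of_real (t * \<xi>)) * \<phi> \<xi>))"
    have TK: "T R \<xi> * \<phi> \<xi> = (LINT t|lborel. K t \<xi>)" for \<xi>
    proof -
      have "T R \<xi> * \<phi> \<xi> = (LINT t|lborel. indicat_real {-R..R} t *\<^sub>R (exp (- \<i> * of_real (t * \<xi>)) * f t) * \<phi> \<xi>)"
        unfolding T_def truncated_fourier_def set_lebesgue_integral_def by (rule integral_mult_left_zero[symmetric])
      also have "\<dots> = (LINT t|lborel. K t \<xi>)"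
        by (intro Bochner_Integration.integral_cong) (auto simp: K_def fR_def)
      finally show ?thesis .
    qed
    have intK: "integrable (lborel \<Otimes>\<^sub>M lborel) (case_prod K)"
    proof (rule Bochner_Integration.integrable_bound[OF integrable_pair_mult[OF intfR int\<phi>]])
      show "case_prod K \<in> borel_measurable (lborel \<Otimes>\<^sub>M lborel)" unfolding K_def by measurable
    qed (auto simp: K_def norm_mult)
    have "A R = (LINT \<xi>|lborel. LINT t|lborel. K t \<xi>)" unfolding A_def TK ..
    also have "\<dots> = (LINT t|lborel. LINT \<xi>|lborel. K t \<xi>)"
      by (rule lborel_pair.Fubini_integral[OF intK])
    also have "\<dots> = (LINT t|lborel. fR R t * of_real (2 * pi * nd t))"
      unfolding K_def \<phi>_def nd_def by (simp only: integral_mult_right_zero fourier_gaussian(2)[OF e])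
    finally show ?thesis using lborel_pair.integrable_snd[OF intK] by (simp add: TK)
  qed
  define L where "L = (LINT t|lborel. f t * of_real (2 * pi * nd t))"
  have limA: "(A \<longlongrightarrow> L) at_top"
    unfolding L_def A[THEN conjunct2, abs_def]
  proof (rule integral_dominated_convergence_at_top)
    show "integrable lborel (\<lambda>t. 2 * pi * nd t)" using e by (simp add: nd_def)
    show "AE t in lborel. ((\<lambda>R. fR R t * of_real (2 * pi * nd t)) \<longlongrightarrow> f t * of_real (2 * pi * nd t)) at_top"
    proof (rule AE_I2, rule tendsto_eventually)
      fix t
      show "\<forall>\<^sub>F R in at_top. fR R t * of_real (2 * pi * nd t) = f t * of_real (2 * pi * nd t)"
        using eventually_ge_at_top[of "\<bar>t\<bar>"] by eventually_elim (auto simp: fR_def indicator_def)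
    qed
    have "cmod (fR R t * of_real (2 * pi * nd t)) \<le> 2 * pi * nd t" for R t
    proof -
      have "cmod (fR R t) \<le> 1" using f1[of t] by (auto simp: fR_def indicator_def)
      moreover have "0 \<le> 2 * pi * nd t" by (simp add: nd_def)
      ultimately show ?thesis by (simp only: norm_mult norm_of_real abs_of_nonneg) (simp add: mult_left_le_one_le)
    qed
    then show "\<forall>\<^sub>F R in at_top. AE t in lborel. norm (fR R t * of_real (2 * pi * nd t)) \<le> 2 * pi * nd t"
      by simp
  qed measurable
  define B where "B = (LINT \<xi>|lborel. F \<xi> * \<phi> \<xi>)"
  define E where "E = (\<lambda>R. \<integral>\<^sup>+ \<xi>. ennreal ((cmod (T R \<xi> - F \<xi>))\<^sup>2) \<partial>lborel)"
  define Q where "Q = (\<integral>\<^sup>+ \<xi>. ennreal ((cmod (\<phi> \<xi>))\<^sup>2) \<partial>lborel)"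
  have Q: "Q < \<infinity>" using int\<phi>2 by (simp add: Q_def integrable_iff_bounded)
  have bound: "ennreal ((cmod (A R - B))\<^sup>2) \<le> Q * E R" for R
  proof -
    have i: "integrable lborel (\<lambda>\<xi>. T R \<xi> * \<phi> \<xi>)" using A by blast
    have "A R - B = (LINT \<xi>|lborel. (T R \<xi> - F \<xi>) * \<phi> \<xi>)"
      unfolding A_def B_def left_diff_distrib by (rule Bochner_Integration.integral_diff[OF i intF\<phi>, symmetric])
    moreover have "integrable lborel (\<lambda>\<xi>. (T R \<xi> - F \<xi>) * \<phi> \<xi>)"
      unfolding left_diff_distrib by (rule Bochner_Integration.integrable_diff[OF i intF\<phi>])
    ultimately have "ennreal (cmod (A R - B)) \<le> (\<integral>\<^sup>+ \<xi>. ennreal (cmod ((T R \<xi> - F \<xi>) * \<phi> \<xi>)) \<partial>lborel)"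
      by (simp only: integral_norm_bound_ennreal)
    also have "\<dots> = (\<integral>\<^sup>+ \<xi>. ennreal (cmod (T R \<xi> - F \<xi>)) * ennreal (cmod (\<phi> \<xi>)) \<partial>lborel)"
      by (simp add: norm_mult ennreal_mult)
    finally have "(ennreal (cmod (A R - B)))\<^sup>2 \<le> (\<integral>\<^sup>+ \<xi>. ennreal (cmod (T R \<xi> - F \<xi>)) * ennreal (cmod (\<phi> \<xi>)) \<partial>lborel)\<^sup>2"
      by (intro power_mono) auto
    also have "\<dots> \<le> (\<integral>\<^sup>+ \<xi>. (ennreal (cmod (T R \<xi> - F \<xi>)))\<^sup>2 \<partial>lborel) * (\<integral>\<^sup>+ \<xi>. (ennreal (cmod (\<phi> \<xi>)))\<^sup>2 \<partial>lborel)"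
      by (rule Cauchy_Schwarz_nn_integral) measurable
    also have "\<dots> = Q * E R" by (simp add: E_def Q_def ennreal_power mult.commute)
    finally show ?thesis by (simp add: ennreal_power)
  qed
  have "ennreal ((cmod (L - B))\<^sup>2) \<le> Q * 0"
  proof (rule tendsto_le)
    show "((\<lambda>R. ennreal ((cmod (A R - B))\<^sup>2)) \<longlongrightarrow> ennreal ((cmod (L - B))\<^sup>2)) at_top"
      by (intro tendsto_intros limA)
    show "((\<lambda>R. Q * E R) \<longlongrightarrow> Q * 0) at_top"
      using FT Q unfolding has_L2_fourier_transform_def E_def T_def by (intro ennreal_tendsto_cmult) auto
  qed (use bound in auto)
  then have "B = L" by (simp add: ennreal_eq_0_iff)
  moreover have "L = of_real (2 * pi) * (LINT s|lborel. std_normal_density s *\<^sub>R f (x + e * s))"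
  proof -
    have "L = e *\<^sub>R (LINT s|lborel. f (x + e * s) * of_real (2 * pi * nd (x + e * s)))"
      unfolding L_def using e by (subst lborel_integral_real_affine[of e _ x]) auto
    also have "(LINT s|lborel. f (x + e * s) * of_real (2 * pi * nd (x + e * s)))
       = (LINT s|lborel. of_real (2 * pi / e) * (std_normal_density s *\<^sub>R f (x + e * s)))"
    proof (rule Bochner_Integration.integral_cong[OF refl])
      fix s
      have "nd (x + e * s) = std_normal_density s / e"
        using e by (simp add: nd_def normal_density_def power_mult_distrib real_sqrt_mult field_simps)
      then show "f (x + e * s) * of_real (2 * pi * nd (x + e * s)) = of_real (2 * pi / e) * (std_normal_density s *\<^sub>R f (x + e * s))"
        by (simp add: scaleR_conv_of_real)
    qed
    also have "\<dots> = of_real (2 * pi / e) * (LINT s|lborel. std_normal_density s *\<^sub>R f (x + e * s))"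
      by (rule integral_mult_right_zero)
    finally show ?thesis using e by (simp add: scaleR_conv_of_real)
  qed
  ultimately show ?thesis by (simp add: B_def \<phi>_def)
qed

text \<open>Since \<open>\<xi>\<close> stays in \<open>[0, 1]\<close>, the exponential series may be integrated term by term, which gives a
power series in \<open>z\<close>, and \<open>|exp (i*z*\<xi>)| = exp (- \<xi> * Im z)\<close> is at most \<open>1\<close> in the upper half-plane.\<close>

lemma fourier_compact_support_holomorphic:
  fixes F :: "real \<Rightarrow> complex"
  assumes F: "integrable lborel F" and supp: "\<And>\<xi>. \<xi> \<notin> {0..1} \<Longrightarrow> F \<xi> = 0"
  shows "(\<lambda>z. LINT \<xi>|lborel. F \<xi> * exp (\<i> * z * of_real \<xi>)) holomorphic_on UNIV"
    and "cmod (LINT \<xi>|lborel. F \<xi> * exp (\<i> * z * of_real \<xi>)) \<le> (LINT \<xi>|lborel. cmod (F \<xi>)) * exp (max 0 (- Im z))"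
proof -
  let ?g = "\<lambda>z. LINT \<xi>|lborel. F \<xi> * exp (\<i> * z * of_real \<xi>)"
  have [measurable]: "F \<in> borel_measurable borel" using F by auto
  define a where "a = (\<lambda>n. LINT \<xi>|lborel. F \<xi> * ((\<i> * of_real \<xi>) ^ n /\<^sub>R fact n))"
  have int: "integrable lborel (\<lambda>\<xi>. F \<xi> * ((\<i> * of_real \<xi>) ^ n /\<^sub>R fact n))" for n
  proof (rule Bochner_Integration.integrable_bound[OF F])
    show "AE \<xi> in lborel. norm (F \<xi> * ((\<i> * of_real \<xi>) ^ n /\<^sub>R fact n)) \<le> norm (F \<xi>)"
    proof (rule AE_I2)
      fix \<xi> :: real
      show "norm (F \<xi> * ((\<i> * of_real \<xi>) ^ n /\<^sub>R fact n)) \<le> norm (F \<xi>)"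
      proof (cases "\<xi> \<in> {0..1}")
        case True
        then have "\<bar>\<xi>\<bar> ^ n \<le> fact n" using order_trans[OF power_le_one[of "\<bar>\<xi>\<bar>" n] fact_ge_1[of n]] by auto
        from mult_right_mono[OF this norm_ge_zero[of "F \<xi>"]]
        show ?thesis by (simp add: norm_mult norm_power divide_simps mult.commute)
      qed (simp add: supp)
    qed
  qed measurable
  have sums: "(\<lambda>n. a n * (w - 0) ^ n) sums ?g w" for w
  proof -
    have part: "(\<Sum>n<N. a n * (w - 0) ^ n) = (LINT \<xi>|lborel. F \<xi> * (\<Sum>n<N. (\<i> * w * of_real \<xi>) ^ n /\<^sub>R fact n))" for N
    proof -
      have "(\<Sum>n<N. a n * (w - 0) ^ n) = (\<Sum>n<N. (LINT \<xi>|lborel. F \<xi> * ((\<i> * of_real \<xi>) ^ n /\<^sub>R fact n) * w ^ n))"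
        unfolding a_def by simp
      also have "\<dots> = (LINT \<xi>|lborel. (\<Sum>n<N. F \<xi> * ((\<i> * of_real \<xi>) ^ n /\<^sub>R fact n) * w ^ n))"
        using int by (intro Bochner_Integration.integral_sum[symmetric] integrable_mult_left) auto
      also have "\<dots> = (LINT \<xi>|lborel. F \<xi> * (\<Sum>n<N. (\<i> * w * of_real \<xi>) ^ n /\<^sub>R fact n))"
      proof (intro Bochner_Integration.integral_cong refl)
        fix \<xi> :: real
        have "F \<xi> * ((\<i> * of_real \<xi>) ^ n /\<^sub>R fact n) * w ^ n = F \<xi> * ((\<i> * w * of_real \<xi>) ^ n /\<^sub>R fact n)" for n
          by (simp add: power_mult_distrib)
        then show "(\<Sum>n<N. F \<xi> * ((\<i> * of_real \<xi>) ^ n /\<^sub>R fact n) * w ^ n) = F \<xi> * (\<Sum>n<N. (\<i> * w * of_real \<xi>) ^ n /\<^sub>R fact n)"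
          by (simp only: sum_distrib_left)
      qed
      finally show ?thesis .
    qed
    have "(\<lambda>N. LINT \<xi>|lborel. F \<xi> * (\<Sum>n<N. (\<i> * w * of_real \<xi>) ^ n /\<^sub>R fact n)) \<longlonglongrightarrow> ?g w"
    proof (rule integral_dominated_convergence)
      show "integrable lborel (\<lambda>\<xi>. cmod (F \<xi>) * exp (cmod w))" using F by simp
      show "AE \<xi> in lborel. (\<lambda>N. F \<xi> * (\<Sum>n<N. (\<i> * w * of_real \<xi>) ^ n /\<^sub>R fact n)) \<longlonglongrightarrow> F \<xi> * exp (\<i> * w * of_real \<xi>)"
        using exp_converges[of "\<i> * w * of_real _"] by (intro AE_I2 tendsto_mult_left) (simp add: sums_def)
      fix N
      show "AE \<xi> in lborel. norm (F \<xi> * (\<Sum>n<N. (\<i> * w * of_real \<xi>) ^ n /\<^sub>R fact n)) \<le> cmod (F \<xi>) * exp (cmod w)"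
      proof (rule AE_I2)
        fix \<xi> :: real
        show "norm (F \<xi> * (\<Sum>n<N. (\<i> * w * of_real \<xi>) ^ n /\<^sub>R fact n)) \<le> cmod (F \<xi>) * exp (cmod w)"
        proof (cases "\<xi> \<in> {0..1}")
          case True
          have "norm (\<Sum>n<N. (\<i> * w * of_real \<xi>) ^ n /\<^sub>R fact n) \<le> (\<Sum>n<N. (cmod w) ^ n /\<^sub>R fact n)"
          proof (rule sum_norm_le)
            fix n
            have "(cmod w * \<bar>\<xi>\<bar>) ^ n \<le> (cmod w) ^ n"
              using True by (intro power_mono) (auto simp: mult_left_le)
            then show "norm ((\<i> * w * of_real \<xi>) ^ n /\<^sub>R fact n) \<le> (cmod w) ^ n /\<^sub>R fact n"
              by (simp add: norm_mult norm_power divide_right_mono power_mult_distrib divide_simps)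
          qed
          also have "\<dots> \<le> exp (cmod w)"
          proof -
            have "summable (\<lambda>n. (cmod w) ^ n /\<^sub>R fact n)" "exp (cmod w) = (\<Sum>n. (cmod w) ^ n /\<^sub>R fact n)"
              using exp_converges[of "cmod w"] by (simp_all only: sums_iff)
            then show ?thesis using sum_le_suminf[of "\<lambda>n. (cmod w) ^ n /\<^sub>R fact n" "{..<N}"] by simp
          qed
          finally show ?thesis by (simp add: norm_mult mult_left_mono)
        qed (simp add: supp)
      qed
    qed measurable
    then show ?thesis unfolding sums_def part .
  qed
  have "?g holomorphic_on ball 0 r" for r by (rule power_series_holomorphic[OF sums])
  then have "?g field_differentiable at z" for z
    by (rule holomorphic_on_imp_differentiable_at[of _ "ball 0 (cmod z + 1)"]) auto
  then show "?g holomorphic_on UNIV" by (simp add: field_differentiable_at_within holomorphic_on_def)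
  have "cmod (?g z) \<le> (LINT \<xi>|lborel. cmod (F \<xi> * exp (\<i> * z * of_real \<xi>)))" by (rule integral_norm_bound)
  also have "\<dots> \<le> (LINT \<xi>|lborel. cmod (F \<xi>) * exp (max 0 (- Im z)))"
  proof (rule integral_mono')
    fix \<xi> :: real
    show "cmod (F \<xi> * exp (\<i> * z * of_real \<xi>)) \<le> cmod (F \<xi>) * exp (max 0 (- Im z))"
    proof (cases "\<xi> \<in> {0..1}")
      case True
      have "- Im z * \<xi> \<le> max 0 (- Im z) * \<xi>" using True by (intro mult_right_mono) auto
      also have "\<dots> \<le> max 0 (- Im z)" using True by (intro mult_left_le) auto
      finally show ?thesis by (simp add: norm_mult norm_exp_eq_Re mult_left_mono)
    qed (simp add: supp)
  qed (use F in auto)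
  finally show "cmod (?g z) \<le> (LINT \<xi>|lborel. cmod (F \<xi>)) * exp (max 0 (- Im z))" by simp
qed

text \<open>For a real function \<open>h\<close> bounded by \<open>1\<close>, the measure with density \<open>h + 1\<close> gives every interval its
length, hence is Lebesgue measure, and densities are unique.\<close>

lemma AE_zero_of_interval_integrals:
  fixes f :: "real \<Rightarrow> complex"
  assumes [measurable]: "f \<in> borel_measurable borel" and f1: "\<And>x. cmod (f x) \<le> 1"
    and int0: "\<And>a b. a \<le> b \<Longrightarrow> (LINT x|lborel. indicat_real {a..b} x *\<^sub>R f x) = 0"
  shows "AE x in lborel. f x = 0"
proof -
  have intf: "integrable lborel (\<lambda>x. indicat_real {a..b} x *\<^sub>R f x)" for a b
  proof (rule Bochner_Integration.integrable_bound)
    show "integrable lborel (indicat_real {a..b})"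
      by (intro integrable_real_indicator) (auto simp: emeasure_lborel_Icc_eq)
    show "AE x in lborel. norm (indicat_real {a..b} x *\<^sub>R f x) \<le> norm (indicat_real {a..b} x)"
      using f1 by (auto simp: mult_left_le)
  qed measurable
  have real: "AE x in lborel. h x = 0"
    if [measurable]: "h \<in> borel_measurable borel" and h1: "\<And>x. \<bar>h x\<bar> \<le> 1"
      and ih: "\<And>a b. a \<le> b \<Longrightarrow> (LINT x|lborel. indicat_real {a..b} x * h x) = 0"
    for h :: "real \<Rightarrow> real"
  proof -
    have nn: "0 \<le> h x + 1" for x using h1[of x] by linarith
    \<comment> \<open>Adding 1 makes the density nonnegative.\<close>
    have "lborel = density lborel (\<lambda>x. ennreal (h x + 1))"
    proof (rule lborel_eqI)
      fix l u :: real assume "\<And>b. b \<in> Basis \<Longrightarrow> l \<bullet> b \<le> u \<bullet> b"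
      then have lu: "l \<le> u" by simp
      have ii: "integrable lborel (indicat_real {l..u})"
        by (intro integrable_real_indicator) (auto simp: emeasure_lborel_Icc_eq)
      have i: "integrable lborel (\<lambda>x. indicat_real {l..u} x * h x)"
      proof (rule Bochner_Integration.integrable_bound[OF ii])
        show "AE x in lborel. norm (indicat_real {l..u} x * h x) \<le> norm (indicat_real {l..u} x)"
          using h1 by (auto simp: abs_mult mult_left_le)
      qed measurable
      have "emeasure (density lborel (\<lambda>x. ennreal (h x + 1))) (box l u)
          = (\<integral>\<^sup>+ x. ennreal (h x + 1) * indicator {l<..<u} x \<partial>lborel)"
        by (simp add: emeasure_density)
      also have "\<dots> = (\<integral>\<^sup>+ x. ennreal (indicat_real {l..u} x * h x + indicat_real {l..u} x) \<partial>lborel)"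
      proof (rule nn_integral_cong_AE)
        show "AE x in lborel. ennreal (h x + 1) * indicator {l<..<u} x = ennreal (indicat_real {l..u} x * h x + indicat_real {l..u} x)"
          using AE_lborel_singleton[of l] AE_lborel_singleton[of u]
          by eventually_elim (auto simp: indicator_def)
      qed
      also have "\<dots> = ennreal (LINT x|lborel. indicat_real {l..u} x * h x + indicat_real {l..u} x)"
      proof (rule nn_integral_eq_integral)
        show "integrable lborel (\<lambda>x. indicat_real {l..u} x * h x + indicat_real {l..u} x)"
          using i ii by (rule Bochner_Integration.integrable_add)
        show "AE x in lborel. 0 \<le> indicat_real {l..u} x * h x + indicat_real {l..u} x"
          using nn by (auto simp: indicator_def)
      qed
      also have "(LINT x|lborel. indicat_real {l..u} x * h x + indicat_real {l..u} x) = u - l"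
        using i ii ih[OF lu] lu by simp
      finally show "emeasure (density lborel (\<lambda>x. ennreal (h x + 1))) (box l u) = (\<Prod>b\<in>Basis. (u - l) \<bullet> b)"
        by simp
    qed simp
    then have "density lborel (\<lambda>x. 1) = density lborel (\<lambda>x. ennreal (h x + 1))"
      by (simp add: density_1)
    then have "AE x in lborel. 1 = ennreal (h x + 1)"
      by (intro sigma_finite_measure.density_unique[OF sigma_finite_lborel]) auto
    then show ?thesis
    proof eventually_elim
      case (elim x)
      then have "ennreal 1 = ennreal (h x + 1)" by simp
      then show ?case using nn[of x] by (subst (asm) ennreal_inj) auto
    qed
  qed
  have "AE x in lborel. Re (f x) = 0"
  proof (rule real)
    show "\<bar>Re (f x)\<bar> \<le> 1" for x using abs_Re_le_cmod f1 order_trans by blast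
    show "(LINT x|lborel. indicat_real {a..b} x * Re (f x)) = 0" if "a \<le> b" for a b
      using integral_Re[OF intf[of a b]] int0[OF that] by simp
  qed measurable
  moreover have "AE x in lborel. Im (f x) = 0"
  proof (rule real)
    show "\<bar>Im (f x)\<bar> \<le> 1" for x using abs_Im_le_cmod f1 order_trans by blast
    show "(LINT x|lborel. indicat_real {a..b} x * Im (f x)) = 0" if "a \<le> b" for a b
      using integral_Im[OF intf[of a b]] int0[OF that] by simp
  qed measurable
  ultimately show ?thesis by eventually_elim (simp add: complex_eq_iff)
qed

text \<open>After a change of variable the translation acts on the interval, whose indicator function is
continuous off the two endpoints.\<close>

lemma interval_integral_translate_tendsto:
  fixes f :: "real \<Rightarrow> complex" and h :: "nat \<Rightarrow> real"
  assumes [measurable]: "f \<in> borel_measurable borel" and f1: "\<And>x. cmod (f x) \<le> 1"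
    and h: "h \<longlonglongrightarrow> 0"
  shows "(\<lambda>k. LINT x|lborel. indicat_real {a..b} x *\<^sub>R f (x + h k)) \<longlonglongrightarrow> (LINT x|lborel. indicat_real {a..b} x *\<^sub>R f x)"
proof -
  have shift: "(LINT x|lborel. indicat_real {a..b} x *\<^sub>R f (x + t)) = (LINT x|lborel. indicat_real {a..b} (x - t) *\<^sub>R f x)" for t
    using lborel_integral_real_affine[of 1 "\<lambda>x. indicat_real {a..b} (x - t) *\<^sub>R f x" t] by (simp add: add.commute)
  obtain c where c: "\<And>k. \<bar>h k\<bar> \<le> c"
    using convergent_imp_Bseq[of h] h by (auto simp: convergent_def Bseq_def)
  show ?thesis unfolding shift
  proof (rule integral_dominated_convergence)
    show "integrable lborel (indicat_real {a - c..b + c})"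
      by (intro integrable_real_indicator) (auto simp: emeasure_lborel_Icc_eq)
    show "AE x in lborel. norm (indicat_real {a..b} (x - h k) *\<^sub>R f x) \<le> indicat_real {a - c..b + c} x" for k
      using c[of k] f1 by (intro AE_I2) (auto simp: indicator_def abs_le_iff)
    show "AE x in lborel. (\<lambda>k. indicat_real {a..b} (x - h k) *\<^sub>R f x) \<longlonglongrightarrow> indicat_real {a..b} x *\<^sub>R f x"
      using AE_lborel_singleton[of a] AE_lborel_singleton[of b]
    proof eventually_elim
      case (elim x)
      have "(\<lambda>k. x - h k) \<longlonglongrightarrow> x - 0" by (intro tendsto_intros h)
      then have lim: "(\<lambda>k. x - h k) \<longlonglongrightarrow> x" by simp
      have "\<forall>\<^sub>F k in sequentially. indicat_real {a..b} (x - h k) = indicat_real {a..b} x"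
      proof (cases "x \<in> {a..b}")
        case True
        then have "a < x" "x < b" using elim by auto
        then have "\<forall>\<^sub>F k in sequentially. a < x - h k" "\<forall>\<^sub>F k in sequentially. x - h k < b"
          using lim by (auto intro: order_tendstoD)
        then show ?thesis by eventually_elim (use True in auto)
      next
        case False
        then consider "x < a" | "b < x" by force
        then show ?thesis
        proof cases
          case 1
          then have "\<forall>\<^sub>F k in sequentially. x - h k < a" using lim by (auto intro: order_tendstoD)
          then show ?thesis by eventually_elim (use 1 in auto)
        next
          case 2
          then have "\<forall>\<^sub>F k in sequentially. b < x - h k" using lim by (auto intro: order_tendstoD)
          then show ?thesis by eventually_elim (use 2 in auto)
        qed
      qed
      then show ?case by (intro tendsto_eventually) (auto elim: eventually_mono)
    qed
  qed measurable
qed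

text \<open>The extension is the inverse Fourier integral, taken at complex arguments. Its values on the real line
are limits of Gaussian averages of \<open>f\<close>, hence bounded by the continuous function \<open>\<omega>\<close> at every point and
not only almost everywhere. It cannot vanish on the line, for then the Gaussian averages of \<open>f\<close> tend
to \<open>0\<close>; integrated over an interval they also tend to the integral of \<open>f\<close>, and \<open>f\<close> would be null.\<close>

lemma bandlimited_entire_extension:
  fixes \<omega> :: "real \<Rightarrow> real"
  assumes f: "L2_fun f" "AE x in lborel. cmod (f x) \<le> \<omega> x" "spec f \<subseteq> {0..1}"
    and nz: "\<not> (AE x in lborel. f x = 0)"
    and \<omega>: "\<And>x. 0 \<le> \<omega> x" "\<And>x. \<omega> x \<le> 1" "continuous_on UNIV \<omega>"
  obtains g C where "g holomorphic_on UNIV" "0 < C"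
    "\<And>z. cmod (g z) \<le> C * exp (max 0 (- Im z))"
    "\<And>x. cmod (g (of_real x)) \<le> \<omega> x" "\<exists>x. g (of_real x) \<noteq> 0"
proof -
  have [measurable]: "f \<in> borel_measurable borel" using f(1) by (simp add: L2_fun_def)
  have [measurable]: "\<omega> \<in> borel_measurable borel" using \<omega>(3) by (rule borel_measurable_continuous_onI)
  obtain F0 where F0: "has_L2_fourier_transform f F0" "AE \<xi> in lborel. \<xi> \<notin> {0..1} \<longrightarrow> F0 \<xi> = 0"
    using spec_subsetE[OF f(3)] by (metis UNIV_I atLeastAtMost_iff not_one_le_zero order_trans zero_le_one linorder_not_le lt_ex)
  have [measurable]: "F0 \<in> borel_measurable borel" using F0(1) by (simp add: has_L2_fourier_transform_def L2_fun_def)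
  \<comment> \<open>Representatives for which the bound and the support condition hold everywhere.\<close>
  define f' where "f' = (\<lambda>x. if cmod (f x) \<le> \<omega> x then f x else 0)"
  define F where "F = (\<lambda>\<xi>. indicat_real {0..1} \<xi> *\<^sub>R F0 \<xi>)"
  have [measurable]: "f' \<in> borel_measurable borel" "F \<in> borel_measurable borel" unfolding f'_def F_def by measurable
  have f'\<omega>: "cmod (f' x) \<le> \<omega> x" for x using \<omega>(1) by (simp add: f'_def)
  have f'1: "cmod (f' x) \<le> 1" for x using f'\<omega>[of x] \<omega>(2)[of x] by linarith
  have ff': "AE x in lborel. f x = f' x" using f(2) by eventually_elim (simp add: f'_def)
  have FT: "has_L2_fourier_transform f' F"
  proof (rule has_L2_fourier_transform_cong_AE[OF F0(1) ff'])
    show "AE \<xi> in lborel. F0 \<xi> = F \<xi>" using F0(2) by eventually_elim (auto simp: F_def indicator_def)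
  qed measurable
  have supp: "F \<xi> = 0" if "\<xi> \<notin> {0..1}" for \<xi> using that by (simp add: F_def)
  have intF: "integrable lborel F"
  proof (rule Bochner_Integration.integrable_bound)
    show "integrable lborel (\<lambda>\<xi>. indicat_real {0..1} \<xi> + (cmod (F \<xi>))\<^sup>2)"
      using FT by (intro Bochner_Integration.integrable_add integrable_real_indicator)
        (auto simp: emeasure_lborel_Icc_eq has_L2_fourier_transform_def L2_fun_def)
    show "AE \<xi> in lborel. norm (F \<xi>) \<le> norm (indicat_real {0..1} \<xi> + (cmod (F \<xi>))\<^sup>2)"
    proof (rule AE_I2)
      fix \<xi> :: real
      have "2 * cmod (F \<xi>) \<le> 1 + (cmod (F \<xi>))\<^sup>2" using sum_squares_bound[of "cmod (F \<xi>)" 1] by simp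
      then have "cmod (F \<xi>) \<le> 1 + (cmod (F \<xi>))\<^sup>2" using norm_ge_zero[of "F \<xi>"] by linarith
      then show "norm (F \<xi>) \<le> norm (indicat_real {0..1} \<xi> + (cmod (F \<xi>))\<^sup>2)"
        using supp[of \<xi>] by (auto simp: indicator_def)
    qed
  qed measurable
  define G where "G = (\<lambda>z. LINT \<xi>|lborel. F \<xi> * exp (\<i> * z * of_real \<xi>))"
  define e where "e = (\<lambda>k::nat. 1 / (real k + 1))"
  have e0: "0 < e k" "e k \<le> 1" for k by (auto simp: e_def)
  have elim: "e \<longlonglongrightarrow> 0" unfolding e_def using LIMSEQ_inverse_real_of_nat by (simp add: inverse_eq_divide add.commute)
  define H where "H = (\<lambda>k x. LINT s|lborel. std_normal_density s *\<^sub>R f' (x + e k * s))"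
  have H_eq: "of_real (2 * pi) * H k x = (LINT \<xi>|lborel. F \<xi> * exp (\<i> * of_real (x * \<xi>) - of_real ((e k)\<^sup>2 * \<xi>\<^sup>2 / 2)))" for k x
    unfolding H_def using gaussian_regularization[OF FT f'1 e0(1)] by simp
  have limG: "(\<lambda>k. of_real (2 * pi) * H k x) \<longlonglongrightarrow> G (of_real x)" for x
    unfolding H_eq G_def
  proof (rule integral_dominated_convergence)
    show "integrable lborel (\<lambda>\<xi>. cmod (F \<xi>))" using intF by simp
    show "AE \<xi> in lborel. norm (F \<xi> * exp (\<i> * of_real (x * \<xi>) - of_real ((e k)\<^sup>2 * \<xi>\<^sup>2 / 2))) \<le> cmod (F \<xi>)" for k
      by (intro AE_I2) (simp add: norm_mult norm_exp_eq_Re mult_left_le)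
    show "AE \<xi> in lborel. (\<lambda>k. F \<xi> * exp (\<i> * of_real (x * \<xi>) - of_real ((e k)\<^sup>2 * \<xi>\<^sup>2 / 2))) \<longlonglongrightarrow> F \<xi> * exp (\<i> * of_real x * of_real \<xi>)"
    proof (rule AE_I2)
      fix \<xi> :: real
      have "(\<lambda>k. F \<xi> * exp (\<i> * of_real (x * \<xi>) - of_real ((e k)\<^sup>2 * \<xi>\<^sup>2 / 2))) \<longlonglongrightarrow> F \<xi> * exp (\<i> * of_real (x * \<xi>) - of_real (0\<^sup>2 * \<xi>\<^sup>2 / 2))"
        by (intro tendsto_intros elim) auto
      then show "(\<lambda>k. F \<xi> * exp (\<i> * of_real (x * \<xi>) - of_real ((e k)\<^sup>2 * \<xi>\<^sup>2 / 2))) \<longlonglongrightarrow> F \<xi> * exp (\<i> * of_real x * of_real \<xi>)"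
        by (simp add: mult.assoc)
    qed
  qed measurable
  \<comment> \<open>The averages of the majorant tend to its value at the point, by continuity.\<close>
  have G\<omega>: "cmod (G (of_real x)) \<le> 2 * pi * \<omega> x" for x
  proof (rule tendsto_le)
    show "(\<lambda>k. cmod (of_real (2 * pi) * H k x)) \<longlonglongrightarrow> cmod (G (of_real x))"
      by (intro tendsto_norm limG)
    have "(\<lambda>k. LINT s|lborel. std_normal_density s * \<omega> (x + e k * s)) \<longlonglongrightarrow> (LINT s|lborel. std_normal_density s * \<omega> x)"
    proof (rule integral_dominated_convergence)
      show "integrable lborel std_normal_density" by simp
      show "AE s in lborel. norm (std_normal_density s * \<omega> (x + e k * s)) \<le> std_normal_density s" for k
        using \<omega> by (intro AE_I2) (simp add: abs_mult mult_left_le)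
      show "AE s in lborel. (\<lambda>k. std_normal_density s * \<omega> (x + e k * s)) \<longlonglongrightarrow> std_normal_density s * \<omega> x"
      proof (rule AE_I2)
        fix s :: real
        have "(\<lambda>k. x + e k * s) \<longlonglongrightarrow> x + 0 * s" by (intro tendsto_intros elim)
        then have "(\<lambda>k. x + e k * s) \<longlonglongrightarrow> x" by simp
        moreover have "isCont \<omega> x" using \<omega>(3) by (simp add: continuous_on_eq_continuous_at)
        ultimately have "(\<lambda>k. \<omega> (x + e k * s)) \<longlonglongrightarrow> \<omega> x" by (rule isCont_tendsto_compose[rotated])
        then show "(\<lambda>k. std_normal_density s * \<omega> (x + e k * s)) \<longlonglongrightarrow> std_normal_density s * \<omega> x"
          by (intro tendsto_intros)
      qed
    qed measurable
    then show "(\<lambda>k. 2 * pi * (LINT s|lborel. std_normal_density s * \<omega> (x + e k * s))) \<longlonglongrightarrow> 2 * pi * \<omega> x"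
      by (intro tendsto_mult_left) simp
    have "cmod (H k x) \<le> (LINT s|lborel. std_normal_density s * \<omega> (x + e k * s))" for k
    proof -
      have "cmod (H k x) \<le> (LINT s|lborel. norm (std_normal_density s *\<^sub>R f' (x + e k * s)))"
        unfolding H_def by (rule integral_norm_bound)
      also have "\<dots> \<le> (LINT s|lborel. std_normal_density s * \<omega> (x + e k * s))"
      proof (rule integral_mono')
        show "integrable lborel (\<lambda>s. std_normal_density s * \<omega> (x + e k * s))"
        proof (rule Bochner_Integration.integrable_bound)
          show "integrable lborel std_normal_density" by simp
          show "AE s in lborel. norm (std_normal_density s * \<omega> (x + e k * s)) \<le> norm (std_normal_density s)"
            using \<omega> by (intro AE_I2) (simp add: abs_mult mult_left_le)
        qed measurable
      qed (auto simp: f'\<omega> mult_left_mono \<omega>)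
      finally show ?thesis .
    qed
    then show "\<forall>\<^sub>F k in sequentially. cmod (of_real (2 * pi) * H k x) \<le> 2 * pi * (LINT s|lborel. std_normal_density s * \<omega> (x + e k * s))"
      by (simp add: norm_mult)
  qed simp
  have G_nz: "\<exists>x. G (of_real x) \<noteq> 0"
  proof (rule ccontr)
    assume "\<not> (\<exists>x. G (of_real x) \<noteq> 0)"
    then have G0: "G (of_real x) = 0" for x by blast
    have H0: "(\<lambda>k. H k x) \<longlonglongrightarrow> 0" for x
      using tendsto_mult_left[OF limG[of x], of "1 / of_real (2 * pi)"] by (simp add: G0)
    have H_meas [measurable]: "H k \<in> borel_measurable borel" for k unfolding H_def by measurable
    have H1: "cmod (H k x) \<le> 1" for k x
    proof -
      have "cmod (H k x) \<le> (LINT s|lborel. norm (std_normal_density s *\<^sub>R f' (x + e k * s)))"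
        unfolding H_def by (rule integral_norm_bound)
      also have "\<dots> \<le> (LINT s|lborel. std_normal_density s)"
        using f'1 by (intro integral_mono') (auto simp: mult_left_le)
      finally show ?thesis by simp
    qed
    have "(LINT x|lborel. indicat_real {a..b} x *\<^sub>R f' x) = 0" for a b
    proof -
      have ii: "integrable lborel (indicat_real {a..b})"
        by (intro integrable_real_indicator) (auto simp: emeasure_lborel_Icc_eq)
      have lim0: "(\<lambda>k. LINT x|lborel. indicat_real {a..b} x *\<^sub>R H k x) \<longlonglongrightarrow> (LINT x|(lborel :: real measure). (0 :: complex))"
      proof (rule integral_dominated_convergence[OF _ _ ii])
        show "AE x in lborel. norm (indicat_real {a..b} x *\<^sub>R H k x) \<le> indicat_real {a..b} x" for k
          using H1 by (intro AE_I2) (simp add: mult_left_le)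
        show "AE x in lborel. (\<lambda>k. indicat_real {a..b} x *\<^sub>R H k x) \<longlonglongrightarrow> 0"
          using tendsto_scaleR[OF tendsto_const H0] by (intro AE_I2) fastforce
      qed measurable
      have swap: "(LINT x|lborel. indicat_real {a..b} x *\<^sub>R H k x)
          = (LINT s|lborel. std_normal_density s *\<^sub>R (LINT x|lborel. indicat_real {a..b} x *\<^sub>R f' (x + e k * s)))" for k
      proof -
        define K where "K = (\<lambda>x s. (indicat_real {a..b} x * std_normal_density s) *\<^sub>R f' (x + e k * s))"
        have "integrable (lborel \<Otimes>\<^sub>M lborel) (case_prod K)"
        proof (rule Bochner_Integration.integrable_bound)
          show "integrable (lborel \<Otimes>\<^sub>M lborel) (\<lambda>(x, s). complex_of_real (indicat_real {a..b} x) * of_real (std_normal_density s))"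
            using ii by (intro integrable_pair_mult) auto
          show "case_prod K \<in> borel_measurable (lborel \<Otimes>\<^sub>M lborel)" unfolding K_def by measurable
          show "AE p in lborel \<Otimes>\<^sub>M lborel. norm (case_prod K p) \<le> norm (case p of (x, s) \<Rightarrow> complex_of_real (indicat_real {a..b} x) * of_real (std_normal_density s))"
            using f'1 by (intro AE_I2) (auto simp: K_def norm_mult abs_mult mult_left_le)
        qed
        from lborel_pair.Fubini_integral[OF this]
        have "(LINT x|lborel. LINT s|lborel. K x s) = (LINT s|lborel. LINT x|lborel. K x s)" by simp
        moreover have "(LINT s|lborel. K x s) = indicat_real {a..b} x *\<^sub>R H k x" for x
          unfolding K_def H_def by (simp only: scaleR_scaleR[symmetric] integral_scaleR_right)
        moreover have "(LINT x|lborel. K x s) = std_normal_density s *\<^sub>R (LINT x|lborel. indicat_real {a..b} x *\<^sub>R f' (x + e k * s))" for s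
          unfolding K_def mult.commute[of "indicat_real _ _"] by (simp only: scaleR_scaleR[symmetric] integral_scaleR_right)
        ultimately show ?thesis by simp
      qed
      let ?I = "LINT x|lborel. indicat_real {a..b} x *\<^sub>R f' x"
      have "(\<lambda>k. LINT s|lborel. std_normal_density s *\<^sub>R (LINT x|lborel. indicat_real {a..b} x *\<^sub>R f' (x + e k * s)))
          \<longlonglongrightarrow> (LINT s|lborel. std_normal_density s *\<^sub>R ?I)"
      proof (rule integral_dominated_convergence)
        let ?c = "LINT x|lborel. indicat_real {a..b} x"
        show "integrable lborel (\<lambda>s. std_normal_density s * ?c)" by simp
        show "AE s in lborel. norm (std_normal_density s *\<^sub>R (LINT x|lborel. indicat_real {a..b} x *\<^sub>R f' (x + e k * s))) \<le> std_normal_density s * ?c" for k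
        proof (rule AE_I2)
          fix s
          have "norm (LINT x|lborel. indicat_real {a..b} x *\<^sub>R f' (x + e k * s)) \<le> (LINT x|lborel. norm (indicat_real {a..b} x *\<^sub>R f' (x + e k * s)))"
            by (rule integral_norm_bound)
          also have "\<dots> \<le> ?c" using f'1 ii by (intro integral_mono') (auto simp: mult_left_le)
          finally show "norm (std_normal_density s *\<^sub>R (LINT x|lborel. indicat_real {a..b} x *\<^sub>R f' (x + e k * s))) \<le> std_normal_density s * ?c"
            by (simp add: mult_left_mono)
        qed
        show "AE s in lborel. (\<lambda>k. std_normal_density s *\<^sub>R (LINT x|lborel. indicat_real {a..b} x *\<^sub>R f' (x + e k * s))) \<longlonglongrightarrow> std_normal_density s *\<^sub>R ?I"
        proof (rule AE_I2)
          fix s :: real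
          have "(\<lambda>k. e k * s) \<longlonglongrightarrow> 0 * s" by (intro tendsto_intros elim)
          then have "(\<lambda>k. e k * s) \<longlonglongrightarrow> 0" by simp
          from interval_integral_translate_tendsto[of f', OF _ f'1 this]
          show "(\<lambda>k. std_normal_density s *\<^sub>R (LINT x|lborel. indicat_real {a..b} x *\<^sub>R f' (x + e k * s))) \<longlonglongrightarrow> std_normal_density s *\<^sub>R ?I"
            by (intro tendsto_intros) measurable
        qed
      qed measurable
      also have "(LINT s|lborel. std_normal_density s *\<^sub>R ?I) = ?I" by simp
      finally show ?thesis using lim0 LIMSEQ_unique unfolding swap by fastforce
    qed
    then have "AE x in lborel. f' x = 0" by (intro AE_zero_of_interval_integrals f'1) auto
    with ff' have "AE x in lborel. f x = 0" by eventually_elim simp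
    with nz show False by blast
  qed
  show ?thesis
  proof (rule that)
    let ?I = "LINT \<xi>|lborel. cmod (F \<xi>)"
    have I0: "0 \<le> ?I" by simp
    show "(\<lambda>z. G z / of_real (2 * pi)) holomorphic_on UNIV"
      unfolding G_def by (intro holomorphic_intros fourier_compact_support_holomorphic(1)[OF intF supp]) auto
    show "0 < ?I + 1" using I0 by linarith
    fix z
    have "cmod (G z / of_real (2 * pi)) \<le> cmod (G z) / 1"
      unfolding norm_divide using pi_gt3 by (intro divide_left_mono) auto
    also have "\<dots> \<le> ?I * exp (max 0 (- Im z))"
      unfolding G_def using fourier_compact_support_holomorphic(2)[OF intF supp] by simp
    also have "\<dots> \<le> (?I + 1) * exp (max 0 (- Im z))" by (intro mult_right_mono) auto
    finally show "cmod (G z / of_real (2 * pi)) \<le> (?I + 1) * exp (max 0 (- Im z))" .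
  next
    fix x
    show "cmod (G (of_real x) / of_real (2 * pi)) \<le> \<omega> x"
      using G\<omega>[of x] by (simp add: norm_divide norm_mult divide_le_eq mult.commute)
    show "\<exists>x. G (of_real x) / of_real (2 * pi) \<noteq> 0" using G_nz by auto
  qed
qed

section \<open>Spread of smallness from a short interval\<close>

text \<open>The Joukowski map \<open>\<zeta> \<mapsto> p + \<eta> * (\<zeta> + 1/\<zeta>) / 2\<close> takes the unit circle onto the segment
\<open>[p - \<eta>, p + \<eta>]\<close> and the exterior of the circle onto the complement of the segment. Thus smallness on a
segment becomes smallness on a circle, and the maximum principle on the annulus \<open>1 \<le> |\<zeta>| \<le> \<rho>\<close>, applied
to the pulled back function divided by \<open>\<zeta>^k\<close>, gives a three circles estimate. An integer exponent \<open>k\<close>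
keeps the quotient single-valued.\<close>

lemma three_circles_joukowski:
  fixes g :: "complex \<Rightarrow> complex" and p \<eta> \<rho> m M :: real
  assumes hol: "g holomorphic_on UNIV" and "0 < \<eta>" "1 < \<rho>"
    and small: "\<And>x::real. \<bar>x - p\<bar> \<le> \<eta> \<Longrightarrow> cmod (g (of_real x)) \<le> m"
    and big: "\<And>z. cmod (z - of_real p) \<le> \<eta> * \<rho> \<Longrightarrow> cmod (g z) \<le> M"
    and mM: "m \<le> M / \<rho> ^ k"
    and \<zeta>: "1 \<le> cmod \<zeta>" "cmod \<zeta> \<le> \<rho>"
  shows "cmod (g (of_real p + of_real \<eta> * (\<zeta> + 1 / \<zeta>) / 2)) \<le> M * (cmod \<zeta> / \<rho>) ^ k"
proof -
  define G where "G = (\<lambda>w. g (of_real p + of_real \<eta> * (w + 1 / w) / 2) / w ^ k)"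
  define S where "S = cball (0::complex) \<rho> - ball 0 1"
  have S0: "w \<noteq> 0" if "w \<in> S" for w using that by (auto simp: S_def)
  have clS: "closed S" unfolding S_def by (intro closed_Diff) auto
  have holG: "G holomorphic_on S" unfolding G_def
    by (intro holomorphic_intros holomorphic_on_compose_gen[OF _ hol, unfolded o_def]) (auto simp: S0)
  have fr: "cmod w = 1 \<or> cmod w = \<rho>" if "w \<in> frontier S" for w
  proof -
    have "w \<in> S" using that clS by (metis frontier_subset_closed subsetD)
    moreover have "w \<notin> interior S" using that by (simp add: frontier_def)
    moreover have "ball 0 \<rho> - cball 0 1 \<subseteq> interior S"
      by (rule interior_maximal) (auto simp: S_def)
    ultimately have "w \<in> S" "w \<notin> ball 0 \<rho> - cball 0 1" by auto
    then show ?thesis by (auto simp: S_def)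
  qed
  have "cmod (G \<zeta>) \<le> M / \<rho> ^ k"
  proof (rule maximum_modulus_frontier[of G S])
    show "G holomorphic_on interior S"
      using holG interior_subset holomorphic_on_subset by blast
    show "continuous_on (closure S) G"
      using holG clS by (simp add: holomorphic_on_imp_continuous_on)
    show "bounded S" by (auto simp: S_def bounded_diff)
    show "\<zeta> \<in> S" using \<zeta> by (auto simp: S_def)
    fix w assume w: "w \<in> frontier S"
    show "cmod (G w) \<le> M / \<rho> ^ k"
    proof (cases "cmod w = 1")
      case True
      have "1 / w = cnj w" using True by (metis complex_div_cnj complex_cnj_one div_by_1 mult.left_neutral of_real_1 one_power2)
      then have "w + 1 / w = of_real (2 * Re w)" by (simp add: complex_add_cnj)
      then have e: "of_real p + of_real \<eta> * (w + 1 / w) / 2 = (of_real (p + \<eta> * Re w) :: complex)" by simp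
      have "\<bar>\<eta> * Re w\<bar> \<le> \<eta> * 1"
        unfolding abs_mult using abs_Re_le_cmod[of w] True \<open>0 < \<eta>\<close> by (intro mult_mono) auto
      then have "cmod (g (of_real (p + \<eta> * Re w))) \<le> m" by (intro small) auto
      then show ?thesis using True mM by (simp add: G_def e norm_divide norm_power del: of_real_add of_real_mult)
    next
      case False
      then have w\<rho>: "cmod w = \<rho>" using fr[OF w] by simp
      have "cmod (w + 1 / w) \<le> \<rho> + 1 / \<rho>"
        using norm_triangle_ineq[of w "1/w"] by (simp add: w\<rho> norm_divide)
      also have "\<dots> \<le> 2 * \<rho>" using \<open>1 < \<rho>\<close>
        by (simp add: field_simps) (smt (verit) mult_less_cancel_left1)
      finally have "\<eta> * cmod (w + 1 / w) / 2 \<le> \<eta> * \<rho>" using \<open>0 < \<eta>\<close> by simp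
      then have "cmod (g (of_real p + of_real \<eta> * (w + 1 / w) / 2)) \<le> M"
        using \<open>0 < \<eta>\<close> by (intro big) (simp add: norm_mult norm_divide)
      then show ?thesis using \<open>1 < \<rho>\<close> by (simp add: G_def norm_divide norm_power w\<rho> divide_right_mono)
    qed
  qed
  moreover have "0 < cmod \<zeta>" using \<zeta> by linarith
  ultimately show ?thesis
    by (simp add: G_def norm_divide norm_power power_divide field_simps)
qed

text \<open>A point at distance at most \<open>s\<close> from \<open>p\<close> is the Joukowski image of a \<open>w\<close> with \<open>|w| \<le> 2*s/\<eta>\<close>. The outer
radius \<open>\<rho>\<close> is \<open>exp 1\<close> times this bound, so that each of the \<open>k\<close> powers of \<open>|w| / \<rho>\<close> contributes a factor
\<open>1 / exp 1\<close>. The hypothesis on \<open>m\<close> shows the logarithmic loss: smallness \<open>exp (- H)\<close> on the segment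
allows \<open>k\<close> to be about \<open>H / ln \<rho>\<close>.\<close>

lemma decay_near_dip:
  fixes g :: "complex \<Rightarrow> complex" and p \<eta> s m M x :: real
  assumes hol: "g holomorphic_on UNIV" and "0 < \<eta>" "\<eta> \<le> s"
    and small: "\<And>x::real. \<bar>x - p\<bar> \<le> \<eta> \<Longrightarrow> cmod (g (of_real x)) \<le> m"
    and big: "\<And>z. cmod (z - of_real p) \<le> 2 * exp 1 * s \<Longrightarrow> cmod (g z) \<le> M"
    and mM: "m \<le> M / (2 * exp 1 * s / \<eta>) ^ k"
    and x: "\<bar>x - p\<bar> \<le> s"
  shows "cmod (g (of_real x)) \<le> M * exp (- real k)"
proof -
  define \<rho> where "\<rho> = 2 * exp 1 * s / \<eta>"
  have e1: "exp 1 \<le> \<rho>" 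
  proof -
    have "exp 1 * 1 \<le> exp 1 * (2 * s / \<eta>)" 
      by (intro mult_left_mono) (use assms in \<open>auto simp: field_simps\<close>)
    then show ?thesis by (simp add: \<rho>_def field_simps)
  qed
  have e2: "(1::real) < exp 1" by simp
  have M: "0 \<le> M" using big[of "of_real p"] assms by (smt (verit) cmod_eq_Re diff_self exp_gt_zero mult_nonneg_nonneg norm_ge_zero norm_zero)
  have exk: "exp (- real k) = (1 / exp 1) ^ k"
    by (simp add: exp_minus power_one_over field_simps flip: exp_of_nat_mult)
  show ?thesis
  proof (cases "\<bar>x - p\<bar> \<le> \<eta>")
    case True
    have "cmod (g (of_real x)) \<le> M * (1 / \<rho>) ^ k" using small[OF True] mM by (simp add: \<rho>_def power_divide)
    also have "\<dots> \<le> M * (1 / exp 1) ^ k"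
      using e1 e2 M by (intro mult_left_mono power_mono divide_left_mono mult_pos_pos divide_nonneg_pos) linarith+
    finally show ?thesis by (simp add: exk)
  next
    case False
    define t where "t = (x - p) / \<eta>"
    \<comment> \<open>The preimage outside the unit circle: the root of w + 1/w = 2*t of larger modulus.\<close>
    define w where "w = sgn t * (\<bar>t\<bar> + sqrt (t\<^sup>2 - 1))"
    have t1: "1 < \<bar>t\<bar>" using False \<open>0 < \<eta>\<close> by (simp add: t_def)
    have t2: "1 < t\<^sup>2" using t1 by (simp add: abs_square_le_1 not_le[symmetric])
    have aw: "\<bar>w\<bar> = \<bar>t\<bar> + sqrt (t\<^sup>2 - 1)" using t1 t2 by (auto simp: w_def abs_mult sgn_if)
    have w1: "1 \<le> \<bar>w\<bar>" using aw t1 t2 by (smt (verit) real_sqrt_ge_zero)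
    have "sqrt (t\<^sup>2 - 1) \<le> \<bar>t\<bar>" by (rule real_le_lsqrt) (auto simp: t2)
    then have "\<bar>w\<bar> \<le> 2 * \<bar>t\<bar>" using aw by linarith
    also have "\<dots> \<le> 2 * s / \<eta>" using x \<open>0 < \<eta>\<close> by (simp add: t_def field_simps)
    finally have w2: "\<bar>w\<bar> \<le> \<rho> / exp 1" by (simp add: \<rho>_def)
    have "w * w - 2 * t * w + 1 = 0"
    proof -
      have "w - t = sgn t * sqrt (t\<^sup>2 - 1)" using t1 by (auto simp: w_def sgn_if algebra_simps)
      then have "(w - t)\<^sup>2 = t\<^sup>2 - 1" using t1 t2 by (auto simp: power_mult_distrib sgn_if)
      then show ?thesis by (simp add: power2_eq_square algebra_simps)
    qed
    then have "w + 1 / w = 2 * t" using w1 by (auto simp: field_simps)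
    then have x_eq: "x = p + \<eta> * (w + 1 / w) / 2" using \<open>0 < \<eta>\<close> by (simp only: t_def) (simp add: field_simps)
    then have xc: "(of_real x :: complex) = of_real p + of_real \<eta> * (of_real w + 1 / of_real w) / 2"
      by (subst x_eq) simp
    have "cmod (g (of_real x)) \<le> M * (cmod (of_real w) / \<rho>) ^ k"
      unfolding xc
    proof (rule three_circles_joukowski[OF hol \<open>0 < \<eta>\<close> _ small _ mM[folded \<rho>_def]])
      show "1 < \<rho>" using e1 e2 by linarith
      show "cmod (g z) \<le> M" if "cmod (z - of_real p) \<le> \<eta> * \<rho>" for z
        using that \<open>0 < \<eta>\<close> by (intro big) (simp add: \<rho>_def)
      show "cmod (of_real w) \<le> \<rho>" 
      proof -
        have "\<rho> / exp 1 \<le> \<rho> / 1" using e1 e2 by (intro divide_left_mono) linarith+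
        then show ?thesis using w2 by simp
      qed
    qed (use w1 in auto)
    also have "\<dots> \<le> M * (1 / exp 1) ^ k"
    proof (intro mult_left_mono power_mono M)
      have "0 < \<rho>" using e1 e2 by linarith
      then show "cmod (of_real w) / \<rho> \<le> 1 / exp 1" "0 \<le> cmod (of_real w) / \<rho>"
        using w2 by (simp_all add: field_simps)
    qed
    finally show ?thesis by (simp add: exk)
  qed
qed

section \<open>Divergent logarithmic integrals in the upper half-plane\<close>

text \<open>The factor \<open>1 / (1 - i*\<epsilon>*z)\<close> has modulus at most \<open>1\<close> in the closed upper half-plane and decays at
infinity. It makes the arc of a large half-disc harmless, so that the maximum principle applies there,
and it disappears as \<open>\<epsilon>\<close> tends to \<open>0\<close>.\<close>

lemma phragmen_lindelof_half_plane:
  fixes G :: "complex \<Rightarrow> complex"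
  assumes hol: "G holomorphic_on {z. 0 < Im z}" and cont: "continuous_on {z. 0 \<le> Im z} G"
    and bdd: "\<And>z. 0 \<le> Im z \<Longrightarrow> cmod (G z) \<le> B"
    and bdry: "\<And>x::real. cmod (G (of_real x)) \<le> M" and "0 < M"
    and z0: "0 \<le> Im z0"
  shows "cmod (G z0) \<le> M"
proof -
  have key: "cmod (G z0) \<le> M * cmod (1 - \<i> * of_real \<epsilon> * z0)" if \<epsilon>: "0 < \<epsilon>" for \<epsilon>
  proof -
    define H where "H = (\<lambda>z. G z / (1 - \<i> * of_real \<epsilon> * z))"
    have Re1: "1 \<le> Re (1 - \<i> * of_real \<epsilon> * z)" if "0 \<le> Im z" for z using that \<epsilon> by simp
    have n1: "1 \<le> cmod (1 - \<i> * of_real \<epsilon> * z)" if "0 \<le> Im z" for z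
      using Re1[OF that] complex_Re_le_cmod order_trans by blast
    then have nz: "1 - \<i> * of_real \<epsilon> * z \<noteq> 0" if "0 \<le> Im z" for z
      using that by (metis norm_zero not_one_le_zero)
    \<comment> \<open>On the circle of this radius, |B| times the modulus of the factor is at most M.\<close>
    define r where "r = max (cmod z0) ((\<bar>B\<bar> / M + 1) / \<epsilon>)"
    have r0: "0 < r" using \<epsilon> \<open>0 < M\<close> unfolding r_def
      by (intro less_max_iff_disj[THEN iffD2] disjI2 divide_pos_pos add_nonneg_pos) auto
    define S where "S = cball (0::complex) r \<inter> {z. 0 \<le> Im z}"
    have clS: "closed S" unfolding S_def by (intro closed_Int closed_halfspace_Im_ge) auto
    have intS: "interior S \<subseteq> {z. 0 < Im z}"
    proof -
      have "interior S \<subseteq> interior {z. 0 \<le> Im z}" by (rule interior_mono) (auto simp: S_def)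
      then show ?thesis using interior_halfspace_ge[of \<i> 0] by (simp add: inner_complex_def)
    qed
    have "cmod (H z0) \<le> M"
    proof (rule maximum_modulus_frontier[of H S])
      show "H holomorphic_on interior S" unfolding H_def
        using intS nz by (intro holomorphic_intros holomorphic_on_subset[OF hol]) auto
      show "continuous_on (closure S) H" unfolding H_def using clS nz
        by (intro continuous_intros continuous_on_subset[OF cont]) (auto simp: S_def)
      show "bounded S" by (auto simp: S_def bounded_Int)
      show "z0 \<in> S" using z0 by (auto simp: S_def r_def)
      fix w assume w: "w \<in> frontier S"
      have wS: "w \<in> S" using w clS by (metis frontier_subset_closed subsetD)
      have "ball 0 r \<inter> {z. 0 < Im z} \<subseteq> interior S"
        by (rule interior_maximal) (auto simp: S_def intro!: open_Int open_halfspace_Im_gt)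
      then have "w \<notin> ball 0 r \<inter> {z. 0 < Im z}" using w by (auto simp: frontier_def)
      then consider "Im w = 0" | "cmod w = r" using wS by (force simp: S_def)
      then show "cmod (H w) \<le> M"
      proof cases
        case 1
        then have "w = of_real (Re w)" by (simp add: complex_eq_iff)
        then have "cmod (G w) \<le> M" using bdry by metis
        moreover have "cmod (H w) \<le> cmod (G w) / 1"
          unfolding H_def norm_divide using n1[of w] 1 by (intro divide_left_mono) auto
        ultimately show ?thesis by simp
      next
        case 2
        have "\<bar>B\<bar> / M + 1 \<le> \<epsilon> * r" using \<epsilon> by (simp add: r_def field_simps max_def)
        moreover have "cmod (1 - \<i> * of_real \<epsilon> * w) \<ge> \<epsilon> * r - 1"
          using norm_triangle_ineq2[of "\<i> * of_real \<epsilon> * w" 1] \<epsilon>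
          by (simp add: norm_mult 2 norm_minus_commute)
        ultimately have "\<bar>B\<bar> / M \<le> cmod (1 - \<i> * of_real \<epsilon> * w)" by linarith
        then have "\<bar>B\<bar> \<le> M * cmod (1 - \<i> * of_real \<epsilon> * w)" using \<open>0 < M\<close> by (simp add: field_simps)
        moreover have "cmod (G w) \<le> \<bar>B\<bar>" using bdd[of w] wS by (force simp: S_def)
        ultimately show ?thesis using n1[of w] wS
\<open>0 < M\<close>
          by (auto simp: H_def norm_divide S_def divide_le_eq)
      qed
    qed
    moreover have "0 < cmod (1 - \<i> * of_real \<epsilon> * z0)" using n1[OF z0] by linarith
    ultimately show ?thesis by (simp only: H_def norm_divide pos_divide_le_eq)
  qed
  have "((\<lambda>\<epsilon>. M * cmod (1 - \<i> * of_real \<epsilon> * z0)) \<longlongrightarrow> M * cmod (1 - \<i> * of_real 0 * z0)) (at_right (0::real))"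
    by (intro tendsto_intros)
  moreover have "\<forall>\<^sub>F \<epsilon> in at_right (0::real). cmod (G z0) \<le> M * cmod (1 - \<i> * of_real \<epsilon> * z0)"
    using key by (auto simp: eventually_at_right_field intro!: exI[of _ 1])
  ultimately have "cmod (G z0) \<le> M * cmod (1 - \<i> * of_real 0 * z0)"
    by (intro tendsto_lowerbound) auto
  then show ?thesis by simp
qed

text \<open>Divided by \<open>\<pi>\<close>, the left-hand side is the harmonic measure of \<open>[a, b]\<close> seen from \<open>z\<close>: the angle that
the interval subtends. The mean value theorem in the variable \<open>t\<close> of \<open>Arg (z - t)\<close> writes it as the
Poisson kernel at an intermediate point, which yields both its lower bound at a fixed \<open>z\<close> and its
smallness far from the interval.\<close>

lemma Arg_difference_mvt:
  fixes a b :: real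
  assumes "a < b" and z: "0 < Im z"
  obtains \<xi> where "a < \<xi>" "\<xi> < b"
    "Im (Ln (z - of_real b)) - Im (Ln (z - of_real a)) = (b - a) * Im z / (cmod (z - of_real \<xi>))\<^sup>2"
proof -
  have d: "((\<lambda>t. Im (Ln (z - of_real t))) has_real_derivative Im (- 1 / (z - of_real t))) (at t)" for t :: real
  proof -
    have "z - of_real t \<notin> \<real>\<^sub>\<le>\<^sub>0" using z by (auto simp: complex_nonpos_Reals_iff)
    then have "((\<lambda>u. Ln (z - u)) has_field_derivative - 1 / (z - of_real t)) (at (of_real t))"
      by (auto intro!: derivative_eq_intros simp: field_simps)
    then have "((\<lambda>u. Ln (z - of_real u)) has_vector_derivative - 1 / (z - of_real t)) (at t)"
      by (rule has_vector_derivative_real_field)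
    from bounded_linear.has_vector_derivative[OF bounded_linear_Im this]
    show ?thesis by (simp add: has_real_derivative_iff_has_vector_derivative)
  qed
  have "\<exists>\<xi>. a < \<xi> \<and> \<xi> < b \<and> Im (Ln (z - of_real b)) - Im (Ln (z - of_real a)) = (b - a) * Im (- 1 / (z - of_real \<xi>))"
    by (rule MVT2[OF \<open>a < b\<close>]) (use d in blast)
  then obtain \<xi> where \<xi>: "a < \<xi>" "\<xi> < b"
    "Im (Ln (z - of_real b)) - Im (Ln (z - of_real a)) = (b - a) * Im (- 1 / (z - of_real \<xi>))"
    by blast
  have "Im (- 1 / (z - of_real \<xi>)) = Im z / (cmod (z - of_real \<xi>))\<^sup>2"
    by (simp add: Im_divide cmod_power2)
  then show ?thesis using that[OF \<xi>(1,2)] \<xi>(3) by simp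
qed

text \<open>Multiply \<open>g\<close> by \<open>exp \<Psi>\<close>, where \<open>Re \<Psi>\<close> is the sum of \<open>D n\<close> times the harmonic measure of an interval
inside the \<open>n\<close>-th block. On the real line the decay of \<open>g\<close> compensates the growth of \<open>exp \<Psi>\<close>, so the
product stays bounded in the half-plane, with a bound that does not depend on the number \<open>N\<close> of
blocks used. At \<open>z0\<close> the harmonic measure of the \<open>n\<close>-th interval is of order \<open>2^(-n)\<close>, so
\<open>Re \<Psi> z0\<close> is unbounded in \<open>N\<close>.

To keep \<open>\<Psi>\<close> continuous up to the real line, the harmonic measures are evaluated at \<open>z + i*\<delta>\<close>. An
interval then has positive harmonic measure also from real points of other blocks; since it is the
middle half of its block, this error is \<open>O(\<delta> * 2^(-n))\<close>, and the choice of \<open>\<delta>\<close> makes the total at most \<open>8\<close>.\<close>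

lemma eq_0_of_log_integral_diverges:
  fixes g :: "complex \<Rightarrow> complex" and D :: "nat \<Rightarrow> real"
  assumes hol: "g holomorphic_on UNIV" and "0 < C"
    and bdd: "\<And>z. 0 \<le> Im z \<Longrightarrow> cmod (g z) \<le> C"
    and decay: "\<And>n x. n0 \<le> n \<Longrightarrow> 2 ^ n \<le> x \<Longrightarrow> x \<le> 2 ^ (n + 1) \<Longrightarrow> cmod (g (of_real x)) \<le> C * exp (- D n)"
    and D: "\<And>n. 0 \<le> D n" "\<And>n. D n \<le> 2 ^ n"
    and div: "\<not> summable (\<lambda>n. D n / 2 ^ n)"
    and z0: "0 < Im z0"
  shows "g z0 = 0"
proof (rule ccontr)
  assume nz: "g z0 \<noteq> 0"
  define a b :: "nat \<Rightarrow> real" where "a = (\<lambda>n. 5 / 4 * 2 ^ n)" and "b = (\<lambda>n. 7 / 4 * 2 ^ n)"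
  define \<theta> where "\<theta> = (\<lambda>n z. (Im (Ln (z - of_real (b n))) - Im (Ln (z - of_real (a n)))) / pi)"
  have \<theta>_eq: "\<exists>\<xi>. a n < \<xi> \<and> \<xi> < b n \<and> \<theta> n z = 2 ^ n / 2 * Im z / (pi * (cmod (z - of_real \<xi>))\<^sup>2)"
    if z: "0 < Im z" for n z
  proof -
    have "a n < b n" by (simp add: a_def b_def)
    from Arg_difference_mvt[OF this z] obtain \<xi> where \<xi>: "a n < \<xi>" "\<xi> < b n"
      "Im (Ln (z - of_real (b n))) - Im (Ln (z - of_real (a n))) = (b n - a n) * Im z / (cmod (z - of_real \<xi>))\<^sup>2"
      by blast
    moreover have "b n - a n = 2 ^ n / 2" by (simp add: a_def b_def)
    ultimately show ?thesis by (auto simp: \<theta>_def mult_ac)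
  qed
  have \<theta>0: "0 \<le> \<theta> n z" if z: "0 < Im z" for n z
    using \<theta>_eq[OF z, of n] z by (auto simp del: divide_le_0_iff)
  have \<theta>1: "\<theta> n z \<le> 1" if z: "0 < Im z" for n z
  proof -
    have "Im (Ln (z - of_real (b n))) \<le> pi"
      using z by (intro Im_Ln_le_pi) (auto simp: complex_eq_iff)
    moreover have "0 \<le> Im (Ln (z - of_real (a n)))"
      using z by (intro less_imp_le) (auto simp: Im_Ln_pos_lt_imp)
    ultimately show ?thesis by (simp add: \<theta>_def)
  qed
  obtain n1 where n1: "n0 \<le> n1" "cmod z0 + 1 \<le> 2 ^ n1"
  proof -
    obtain k where k: "cmod z0 + 1 < 2 ^ k" using real_arch_pow[of 2 "cmod z0 + 1"] by auto
    have "(2::real) ^ k \<le> 2 ^ max n0 k" by (intro power_increasing) auto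
    then show ?thesis using k by (intro that[of "max n0 k"]) linarith+
  qed
  define c where "c = Im z0 / (18 * pi)"
  have c: "0 < c" using z0 by (simp add: c_def)
  have main: "cmod (g z0) * exp (c * (\<Sum>n=n1..<N. D n / 2 ^ n)) \<le> C * exp 8" for N
  proof -
    define \<delta> where "\<delta> = 1 / (real N + 1)"
    have \<delta>: "0 < \<delta>" "\<delta> \<le> 1" "\<delta> * real N \<le> 1" by (auto simp: \<delta>_def field_simps)
    define \<Psi> where "\<Psi> = (\<lambda>z. \<Sum>n=n1..<N. of_real (D n) * (- \<i> / of_real pi *
        (Ln (z + \<i> * of_real \<delta> - of_real (b n)) - Ln (z + \<i> * of_real \<delta> - of_real (a n)))))"
    have Re\<Psi>: "Re (\<Psi> z) = (\<Sum>n=n1..<N. D n * \<theta> n (z + \<i> * of_real \<delta>))" for z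
      unfolding \<Psi>_def \<theta>_def Re_sum by (intro sum.cong refl) (simp add: field_simps)
    have Im\<delta>: "0 < Im (z + \<i> * of_real \<delta>)" if "0 \<le> Im z" for z using that \<delta> by simp
    have hol\<Psi>: "\<Psi> holomorphic_on {z. 0 \<le> Im z}" unfolding \<Psi>_def
      using \<delta> by (intro holomorphic_intros) (auto simp: complex_nonpos_Reals_iff)
    have bd\<Psi>: "Re (\<Psi> z) \<le> (\<Sum>n=n1..<N. D n)" if "0 \<le> Im z" for z
      unfolding Re\<Psi> using \<theta>1[OF Im\<delta>[OF that]] D(1) by (intro sum_mono mult_left_le) auto
    define G where "G = (\<lambda>z. g z * exp (\<Psi> z))"
    have holG: "G holomorphic_on {z. 0 \<le> Im z}" unfolding G_def
      by (intro holomorphic_intros hol\<Psi> holomorphic_on_subset[OF hol]) auto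
    have "cmod (G z0) \<le> C * exp 8"
    proof (rule phragmen_lindelof_half_plane[where G = G and ?z0.0 = z0 and B = "C * exp (\<Sum>n=n1..<N. D n)"])
      show "G holomorphic_on {z. 0 < Im z}" by (rule holomorphic_on_subset[OF holG]) auto
      show "continuous_on {z. 0 \<le> Im z} G" using holG by (rule holomorphic_on_imp_continuous_on)
      show "cmod (G z) \<le> C * exp (\<Sum>n=n1..<N. D n)" if "0 \<le> Im z" for z
        unfolding G_def norm_mult norm_exp_eq_Re using bdd[OF that] bd\<Psi>[OF that] \<open>0 < C\<close>
        by (intro mult_mono) auto
      show "0 < C * exp 8" "0 \<le> Im z0" using \<open>0 < C\<close> z0 by auto
      fix x :: real
      define Jx where "Jx = (\<lambda>n::nat. 2 ^ n \<le> x \<and> x < 2 ^ (n + 1))"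
      have far: "D n * \<theta> n (of_real x + \<i> * of_real \<delta>) \<le> (if Jx n then D n else 0) + 8 * \<delta>" for n
      proof (cases "Jx n")
        case True
        have "D n * \<theta> n (of_real x + \<i> * of_real \<delta>) \<le> D n" using \<theta>1 D \<delta> by (intro mult_left_le) auto
        then show ?thesis using True \<delta> by simp
      next
        case False
        obtain \<xi> where \<xi>: "a n < \<xi>" "\<xi> < b n" "\<theta> n (of_real x + \<i> * of_real \<delta>)
             = 2 ^ n / 2 * \<delta> / (pi * (cmod (of_real x + \<i> * of_real \<delta> - of_real \<xi>))\<^sup>2)"
          using \<theta>_eq[of "of_real x + \<i> * of_real \<delta>" n] \<delta> by auto
        have "2 ^ n / 4 \<le> \<bar>x - \<xi>\<bar>" using False \<xi>(1,2) by (auto simp: Jx_def a_def b_def)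
        also have "\<dots> \<le> cmod (of_real x + \<i> * of_real \<delta> - of_real \<xi>)"
          using abs_Re_le_cmod[of "of_real x + \<i> * of_real \<delta> - of_real \<xi>"] by simp
        finally have "(2 ^ n / 4)\<^sup>2 \<le> (cmod (of_real x + \<i> * of_real \<delta> - of_real \<xi>))\<^sup>2"
          by (intro power_mono) auto
        then have "1 * (2 ^ n / 4)\<^sup>2 \<le> pi * (cmod (of_real x + \<i> * of_real \<delta> - of_real \<xi>))\<^sup>2"
          using pi_gt3 by (intro mult_mono) auto
        then have "\<theta> n (of_real x + \<i> * of_real \<delta>) \<le> 2 ^ n / 2 * \<delta> / (1 * (2 ^ n / 4)\<^sup>2)"
          unfolding \<xi>(3) using \<delta> by (intro divide_left_mono mult_pos_pos) (auto intro: less_le_trans[rotated])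
        also have "\<dots> = 8 * \<delta> / 2 ^ n" by (simp add: power2_eq_square field_simps)
        finally have "D n * \<theta> n (of_real x + \<i> * of_real \<delta>) \<le> 2 ^ n * (8 * \<delta> / 2 ^ n)"
          using D \<theta>0[of "of_real x + \<i> * of_real \<delta>"] \<delta> by (intro mult_mono) auto
        then show ?thesis using False by simp
      qed
      have "Re (\<Psi> (of_real x)) \<le> (\<Sum>n=n1..<N. (if Jx n then D n else 0) + 8 * \<delta>)"
        unfolding Re\<Psi> by (intro sum_mono far)
      also have "\<dots> \<le> (\<Sum>n=n1..<N. if Jx n then D n else 0) + 8 * (\<delta> * real N)"
        using \<delta> by (auto simp: sum.distrib field_simps mult_left_mono)
      also have "\<dots> \<le> (\<Sum>n=n1..<N. if Jx n then D n else 0) + 8" using \<delta> by simp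
      finally have Re1: "Re (\<Psi> (of_real x)) \<le> (\<Sum>n=n1..<N. if Jx n then D n else 0) + 8" .
      have g1: "cmod (g (of_real x)) \<le> C * exp (- (\<Sum>n=n1..<N. if Jx n then D n else 0))"
      proof (cases "\<exists>m\<in>{n1..<N}. Jx m")
        case True
        then obtain m where m: "m \<in> {n1..<N}" "Jx m" by blast
        have "n = m" if "Jx n" for n
        proof -
          have "(2::real) ^ n < 2 ^ (m + 1)" "(2::real) ^ m < 2 ^ (n + 1)"
            using that m(2) unfolding Jx_def by linarith+
          then have "n < m + 1" "m < n + 1"
            by (simp_all only: power_strict_increasing_iff[of "2::real"] one_less_numeral_iff semiring_norm)
          then show ?thesis by simp
        qed
        then have "(\<Sum>n=n1..<N. if Jx n then D n else 0) = (\<Sum>n=n1..<N. if n = m then D n else 0)"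
          using m(2) by (intro sum.cong refl if_cong) blast+
        also have "\<dots> = D m" using m by simp
        finally show ?thesis using decay[of m x] m n1 by (auto simp: Jx_def)
      next
        case False
        then have "(\<Sum>n=n1..<N. if Jx n then D n else 0) = 0" by (intro sum.neutral) auto
        then show ?thesis using bdd[of "of_real x"] by simp
      qed
      have "cmod (G (of_real x)) \<le> C * exp (- (\<Sum>n=n1..<N. if Jx n then D n else 0))
          * exp ((\<Sum>n=n1..<N. if Jx n then D n else 0) + 8)"
        unfolding G_def norm_mult norm_exp_eq_Re using g1 Re1 \<open>0 < C\<close> by (intro mult_mono) auto
      also have "\<dots> = C * exp 8" by (simp add: exp_add exp_minus)
      finally show "cmod (G (of_real x)) \<le> C * exp 8" .
    qed
    moreover have "c * (\<Sum>n=n1..<N. D n / 2 ^ n) \<le> Re (\<Psi> z0)"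
      unfolding Re\<Psi> sum_distrib_left
    proof (rule sum_mono)
      fix n assume n: "n \<in> {n1..<N}"
      let ?z = "z0 + \<i> * of_real \<delta>"
      have Imz: "0 < Im ?z" using z0 \<delta> by simp
      obtain \<xi> where \<xi>: "a n < \<xi>" "\<xi> < b n" "\<theta> n ?z = 2 ^ n / 2 * Im ?z / (pi * (cmod (?z - of_real \<xi>))\<^sup>2)"
        using \<theta>_eq[OF Imz] by blast
      have "0 < a n" by (simp add: a_def)
      have "(2::real) ^ n1 \<le> 2 ^ n" using n by (intro power_increasing) auto
      then have z1: "cmod z0 + 1 \<le> 2 ^ n" using n1 by linarith
      have "cmod (?z - of_real \<xi>) \<le> cmod ?z + \<bar>\<xi>\<bar>"
        using norm_triangle_ineq4[of ?z "of_real \<xi>"] by simp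
      also have "cmod ?z \<le> cmod z0 + \<delta>" using norm_triangle_ineq[of z0 "\<i> * of_real \<delta>"] \<delta> by (simp add: norm_mult)
      also have "\<bar>\<xi>\<bar> \<le> 2 * 2 ^ n" using \<xi>(1,2) \<open>0 < a n\<close> by (simp add: b_def)
      finally have "cmod (?z - of_real \<xi>) \<le> 3 * 2 ^ n" using z1 \<delta> by linarith
      then have "(cmod (?z - of_real \<xi>))\<^sup>2 \<le> (3 * 2 ^ n)\<^sup>2" by (intro power_mono) auto
      moreover have "0 < cmod (?z - of_real \<xi>)" using Imz by (auto simp: complex_eq_iff)
      ultimately have "2 ^ n / 2 * Im z0 / (pi * (3 * 2 ^ n)\<^sup>2) \<le> \<theta> n ?z"
        unfolding \<xi>(3) using z0 \<delta> by (intro frac_le mult_mono mult_left_mono mult_pos_pos) auto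
      moreover have "2 ^ n / 2 * Im z0 / (pi * (3 * 2 ^ n)\<^sup>2) = c / 2 ^ n"
        by (simp add: c_def power2_eq_square field_simps)
      ultimately have "D n * (c / 2 ^ n) \<le> D n * \<theta> n ?z" using D by (intro mult_left_mono) auto
      then show "c * (D n / 2 ^ n) \<le> D n * \<theta> n ?z" by (simp add: mult_ac)
    qed
    then have "cmod (g z0) * exp (c * (\<Sum>n=n1..<N. D n / 2 ^ n)) \<le> cmod (G z0)"
      by (simp add: G_def norm_mult mult_left_mono)
    ultimately show ?thesis by linarith
  qed
  have "(\<Sum>n<N. D (n + n1) / 2 ^ (n + n1)) \<le> ln (C * exp 8 / cmod (g z0)) / c" for N
  proof -
    have "(\<Sum>n<N. D (n + n1) / 2 ^ (n + n1)) = (\<Sum>n=n1..<N+n1. D n / 2 ^ n)"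
      using sum.shift_bounds_nat_ivl[of "\<lambda>n. D n / 2 ^ n" 0 n1 N] by (simp add: atLeast0LessThan)
    moreover have "exp (c * (\<Sum>n=n1..<N+n1. D n / 2 ^ n)) \<le> C * exp 8 / cmod (g z0)"
      using main[of "N + n1"] nz by (simp add: field_simps)
    then have "c * (\<Sum>n=n1..<N+n1. D n / 2 ^ n) \<le> ln (C * exp 8 / cmod (g z0))"
      using \<open>0 < C\<close> nz by (simp add: ln_ge_iff)
    ultimately show ?thesis using c by (simp add: field_simps)
  qed
  then have "summable (\<lambda>n. D (n + n1) / 2 ^ (n + n1))"
    by (intro summableI_nonneg_bounded) (use D in auto)
  then show False using div summable_iff_shift[of "\<lambda>n. D n / 2 ^ n" n1] by blast
qed

section \<open>Absolute continuity on intervals\<close>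

text \<open>The hypothesis on the intervals in the definition of absolute continuity, without the bound on their
total length.\<close>

definition disjoint_subintervals :: "real \<Rightarrow> real \<Rightarrow> nat \<Rightarrow> (nat \<Rightarrow> real) \<Rightarrow> (nat \<Rightarrow> real) \<Rightarrow> bool" where
  "disjoint_subintervals a b n u v \<longleftrightarrow> (\<forall>i<n. a \<le> u i \<and> u i \<le> v i \<and> v i \<le> b) \<and>
     disjoint_family_on (\<lambda>i. {u i<..<v i}) {..<n}"

lemma abs_continuous_on_interval_iff:
  "abs_continuous_on_interval f a b \<longleftrightarrow>
     (\<forall>\<epsilon>>0. \<exists>\<delta>>0. \<forall>n u v. disjoint_subintervals a b n u v \<longrightarrow> (\<Sum>i<n. v i - u i) < \<delta>
        \<longrightarrow> (\<Sum>i<n. \<bar>f (v i) - f (u i)\<bar>) < \<epsilon>)"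
  unfolding abs_continuous_on_interval_def disjoint_subintervals_def by (simp only: conj_assoc imp_conjL)

lemma abs_continuous_on_intervalI:
  assumes "\<And>\<epsilon>. 0 < \<epsilon> \<Longrightarrow> \<exists>\<delta>>0. \<forall>n u v. disjoint_subintervals a b n u v \<longrightarrow>
     (\<Sum>i<n. v i - u i) < \<delta> \<longrightarrow> (\<Sum>i<n. \<bar>f (v i) - f (u i)\<bar>) < \<epsilon>"
  shows "abs_continuous_on_interval f a b"
  using assms unfolding abs_continuous_on_interval_iff by blast

lemma abs_continuous_on_intervalD:
  assumes "abs_continuous_on_interval f a b" "0 < \<epsilon>"
  obtains \<delta> where "0 < \<delta>" "\<And>n u v. disjoint_subintervals a b n u v \<Longrightarrow> (\<Sum>i<n. v i - u i) < \<delta>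
    \<Longrightarrow> (\<Sum>i<n. \<bar>f (v i) - f (u i)\<bar>) < \<epsilon>"
  using assms unfolding abs_continuous_on_interval_iff by blast

lemma abs_continuous_on_interval_cong:
  assumes "\<And>x. a \<le> x \<Longrightarrow> x \<le> b \<Longrightarrow> f x = g x" "abs_continuous_on_interval f a b"
  shows "abs_continuous_on_interval g a b"
proof (rule abs_continuous_on_intervalI)
  fix \<epsilon> :: real assume "0 < \<epsilon>"
  obtain \<delta> where \<delta>: "0 < \<delta>" "\<And>n u v. disjoint_subintervals a b n u v \<Longrightarrow> (\<Sum>i<n. v i - u i) < \<delta> \<Longrightarrow> (\<Sum>i<n. \<bar>f (v i) - f (u i)\<bar>) < \<epsilon>"
    using abs_continuous_on_intervalD[OF assms(2) \<open>0 < \<epsilon>\<close>] by blast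
  show "\<exists>\<delta>>0. \<forall>n u v. disjoint_subintervals a b n u v \<longrightarrow>
        (\<Sum>i<n. v i - u i) < \<delta> \<longrightarrow> (\<Sum>i<n. \<bar>g (v i) - g (u i)\<bar>) < \<epsilon>"
  proof (intro exI[of _ \<delta>] conjI allI impI)
    fix n and u v :: "nat \<Rightarrow> real"
    assume uv: "disjoint_subintervals a b n u v"
      "(\<Sum>i<n. v i - u i) < \<delta>"
    have "(\<Sum>i<n. \<bar>g (v i) - g (u i)\<bar>) = (\<Sum>i<n. \<bar>f (v i) - f (u i)\<bar>)"
    proof (rule sum.cong[OF refl])
      fix i assume "i \<in> {..<n}"
      then have "a \<le> u i" "u i \<le> v i" "v i \<le> b" using uv(1) by (auto simp: disjoint_subintervals_def)
      then show "\<bar>g (v i) - g (u i)\<bar> = \<bar>f (v i) - f (u i)\<bar>" using assms(1)[of "u i"] assms(1)[of "v i"] by simp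
    qed
    also have "\<dots> < \<epsilon>" using \<delta>(2)[of n u v] uv by blast
    finally show "(\<Sum>i<n. \<bar>g (v i) - g (u i)\<bar>) < \<epsilon>" .
  qed (rule \<delta>(1))
qed

lemma abs_continuous_on_interval_add:
  assumes "abs_continuous_on_interval f a b" "abs_continuous_on_interval g a b"
  shows "abs_continuous_on_interval (\<lambda>x. f x + g x) a b"
proof (rule abs_continuous_on_intervalI)
  fix \<epsilon> :: real assume "0 < \<epsilon>"
  then have e2: "0 < \<epsilon> / 2" by simp
  obtain \<delta>1 where \<delta>1: "0 < \<delta>1" "\<And>n u v. disjoint_subintervals a b n u v \<Longrightarrow> (\<Sum>i<n. v i - u i) < \<delta>1 \<Longrightarrow> (\<Sum>i<n. \<bar>f (v i) - f (u i)\<bar>) < \<epsilon> / 2"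
    using abs_continuous_on_intervalD[OF assms(1) e2] by blast
  obtain \<delta>2 where \<delta>2: "0 < \<delta>2" "\<And>n u v. disjoint_subintervals a b n u v \<Longrightarrow> (\<Sum>i<n. v i - u i) < \<delta>2 \<Longrightarrow> (\<Sum>i<n. \<bar>g (v i) - g (u i)\<bar>) < \<epsilon> / 2"
    using abs_continuous_on_intervalD[OF assms(2) e2] by blast
  show "\<exists>\<delta>>0. \<forall>n u v. disjoint_subintervals a b n u v \<longrightarrow>
        (\<Sum>i<n. v i - u i) < \<delta> \<longrightarrow> (\<Sum>i<n. \<bar>f (v i) + g (v i) - (f (u i) + g (u i))\<bar>) < \<epsilon>"
  proof (intro exI[of _ "min \<delta>1 \<delta>2"] conjI allI impI)
    fix n and u v :: "nat \<Rightarrow> real"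
    assume uv: "disjoint_subintervals a b n u v"
      "(\<Sum>i<n. v i - u i) < min \<delta>1 \<delta>2"
    have "(\<Sum>i<n. \<bar>f (v i) + g (v i) - (f (u i) + g (u i))\<bar>)
        \<le> (\<Sum>i<n. \<bar>f (v i) - f (u i)\<bar> + \<bar>g (v i) - g (u i)\<bar>)"
      by (intro sum_mono) linarith
    also have "\<dots> = (\<Sum>i<n. \<bar>f (v i) - f (u i)\<bar>) + (\<Sum>i<n. \<bar>g (v i) - g (u i)\<bar>)" by (rule sum.distrib)
    also have "\<dots> < \<epsilon> / 2 + \<epsilon> / 2"
      using uv by (intro add_strict_mono \<delta>1(2) \<delta>2(2)) auto
    finally show "(\<Sum>i<n. \<bar>f (v i) + g (v i) - (f (u i) + g (u i))\<bar>) < \<epsilon>" by simp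
  qed (use \<delta>1 \<delta>2 in auto)
qed

lemma abs_continuous_on_interval_lipschitz_comp:
  assumes f: "abs_continuous_on_interval f a b" and L: "0 < L" "\<And>s t. \<bar>\<phi> s - \<phi> t\<bar> \<le> L * \<bar>s - t\<bar>"
  shows "abs_continuous_on_interval (\<lambda>x. \<phi> (f x)) a b"
proof (rule abs_continuous_on_intervalI)
  fix \<epsilon> :: real assume "0 < \<epsilon>"
  then have eL: "0 < \<epsilon> / L" using L by simp
  obtain \<delta> where \<delta>: "0 < \<delta>" "\<And>n u v. disjoint_subintervals a b n u v \<Longrightarrow> (\<Sum>i<n. v i - u i) < \<delta> \<Longrightarrow> (\<Sum>i<n. \<bar>f (v i) - f (u i)\<bar>) < \<epsilon> / L"
    using abs_continuous_on_intervalD[OF f eL] by blast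
  show "\<exists>\<delta>>0. \<forall>n u v. disjoint_subintervals a b n u v \<longrightarrow>
        (\<Sum>i<n. v i - u i) < \<delta> \<longrightarrow> (\<Sum>i<n. \<bar>\<phi> (f (v i)) - \<phi> (f (u i))\<bar>) < \<epsilon>"
  proof (intro exI[of _ \<delta>] conjI allI impI)
    fix n and u v :: "nat \<Rightarrow> real"
    assume uv: "disjoint_subintervals a b n u v"
      "(\<Sum>i<n. v i - u i) < \<delta>"
    have "(\<Sum>i<n. \<bar>\<phi> (f (v i)) - \<phi> (f (u i))\<bar>) \<le> L * (\<Sum>i<n. \<bar>f (v i) - f (u i)\<bar>)"
      unfolding sum_distrib_left by (intro sum_mono L)
    also have "\<dots> < L * (\<epsilon> / L)" using \<delta>(2)[of n u v] uv L by (intro mult_strict_left_mono) auto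
    finally show "(\<Sum>i<n. \<bar>\<phi> (f (v i)) - \<phi> (f (u i))\<bar>) < \<epsilon>" using L by simp
  qed (rule \<delta>(1))
qed

lemma abs_continuous_on_interval_const: "abs_continuous_on_interval (\<lambda>x. c) a b"
  by (rule abs_continuous_on_intervalI) (auto intro: exI[of _ 1])

lemma abs_continuous_on_interval_sum:
  assumes "\<And>i. i \<in> I \<Longrightarrow> abs_continuous_on_interval (f i) a b"
  shows "abs_continuous_on_interval (\<lambda>x. \<Sum>i\<in>I. f i x) a b"
  using assms
  by (induction I rule: infinite_finite_induct)
     (auto intro: abs_continuous_on_interval_const abs_continuous_on_interval_add)

lemma abs_continuous_on_interval_reflect:
  assumes f: "abs_continuous_on_interval f (- b) (- a)"
  shows "abs_continuous_on_interval (\<lambda>x. f (- x)) a b"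
proof (rule abs_continuous_on_intervalI)
  fix \<epsilon> :: real assume "0 < \<epsilon>"
  obtain \<delta> where \<delta>: "0 < \<delta>" "\<And>n u v. disjoint_subintervals (- b) (- a) n u v \<Longrightarrow> (\<Sum>i<n. v i - u i) < \<delta> \<Longrightarrow> (\<Sum>i<n. \<bar>f (v i) - f (u i)\<bar>) < \<epsilon>"
    using abs_continuous_on_intervalD[OF f \<open>0 < \<epsilon>\<close>] by blast
  show "\<exists>\<delta>>0. \<forall>n u v. disjoint_subintervals a b n u v \<longrightarrow>
        (\<Sum>i<n. v i - u i) < \<delta> \<longrightarrow> (\<Sum>i<n. \<bar>f (- v i) - f (- u i)\<bar>) < \<epsilon>"
  proof (intro exI[of _ \<delta>] conjI allI impI)
    fix n and u v :: "nat \<Rightarrow> real"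
    assume uv: "disjoint_subintervals a b n u v"
      "(\<Sum>i<n. v i - u i) < \<delta>"
    have disj: "disjoint_family_on (\<lambda>i. {u i<..<v i}) {..<n}" using uv(1) by (simp add: disjoint_subintervals_def)
    have "disjoint_family_on (\<lambda>i. {- v i<..<- u i}) {..<n}"
    proof (unfold disjoint_family_on_def, intro ballI impI equals0I)
      fix i k x assume ik: "i \<in> {..<n}" "k \<in> {..<n}" "i \<noteq> k" and "x \<in> {- v i<..<- u i} \<inter> {- v k<..<- u k}"
      then have "- x \<in> {u i<..<v i} \<inter> {u k<..<v k}" by auto
      then show False using disjoint_family_onD[OF disj ik] by blast
    qed
    then have "(\<Sum>i<n. \<bar>f (- u i) - f (- v i)\<bar>) < \<epsilon>"
      using uv \<delta>(2)[of n "\<lambda>i. - v i" "\<lambda>i. - u i"] by (auto simp: disjoint_subintervals_def)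
    then show "(\<Sum>i<n. \<bar>f (- v i) - f (- u i)\<bar>) < \<epsilon>" by (simp add: abs_minus_commute)
  qed (rule \<delta>(1))
qed

text \<open>A monotone function carries disjoint intervals to disjoint intervals, whose lengths add up to at most
the length of the range.\<close>

lemma mono_increments_le:
  fixes f :: "real \<Rightarrow> real"
  assumes f: "mono f" "\<And>x. 0 \<le> f x" "\<And>x. f x \<le> B"
    and uv: "\<And>i. i < (n::nat) \<Longrightarrow> u i \<le> v i" and disj: "disjoint_family_on (\<lambda>i. {u i<..<v i}) {..<n}"
  shows "(\<Sum>i<n. f (v i) - f (u i)) \<le> B"
proof -
  define I where "I = (\<lambda>i. {f (u i)<..<f (v i)})"
  have fuv: "f (u i) \<le> f (v i)" if "i < n" for i using f(1) uv[OF that] by (rule monoD)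
  have dI: "disjoint_family_on I {..<n}"
  proof (unfold disjoint_family_on_def, intro ballI impI equals0I)
    fix i k y assume ik: "i \<in> {..<n}" "k \<in> {..<n}" "i \<noteq> k" and "y \<in> I i \<inter> I k"
    then have y: "f (u i) < y" "y < f (v i)" "f (u k) < y" "y < f (v k)" by (auto simp: I_def)
    have 1: "u i < v i" "u k < v k" "u i < v k" "u k < v i"
      using y monoD[OF f(1), of "v i" "u i"] monoD[OF f(1), of "v k" "u k"]
        monoD[OF f(1), of "v k" "u i"] monoD[OF f(1), of "v i" "u k"] by linarith+
    then obtain x where "max (u i) (u k) < x" "x < min (v i) (v k)" using dense[of "max (u i) (u k)" "min (v i) (v k)"] by auto
    then have "x \<in> {u i<..<v i} \<inter> {u k<..<v k}" by auto
    then show False using disjoint_family_onD[OF disj ik] by blast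
  qed
  have "(\<Sum>i<n. f (v i) - f (u i)) = (\<Sum>i<n. measure lborel (I i))"
    using fuv by (intro sum.cong) (auto simp: I_def)
  also have "\<dots> = measure lborel (\<Union>i\<in>{..<n}. I i)"
    using dI fuv by (intro measure_finite_Union[symmetric]) (auto simp: I_def)
  also have "\<dots> \<le> measure lborel {0..B}"
  proof (rule measure_mono_fmeasurable)
    have "0 < y \<and> y < B" if "y \<in> I i" for y i
      using that f(2)[of "u i"] f(3)[of "v i"] by (auto simp: I_def)
    then show "(\<Union>i\<in>{..<n}. I i) \<subseteq> {0..B}" by force
    show "(\<Union>i\<in>{..<n}. I i) \<in> sets lborel" by (auto simp: I_def)
    show "{0..B} \<in> fmeasurable lborel" by (auto intro: fmeasurableI simp: emeasure_lborel_Icc_eq)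
  qed
  also have "\<dots> = B" using f(2)[of 0] f(3)[of 0] by simp
  finally show ?thesis .
qed

text \<open>Subadditivity of the power: \<open>p \<le> p^\<beta>\<close> for the two fractions \<open>u/v\<close> and \<open>(v-u)/v\<close>, whose sum is \<open>1\<close>.\<close>

lemma powr_subadditive_diff:
  fixes u v \<beta> :: real
  assumes "0 \<le> u" "u \<le> v" "0 < \<beta>" "\<beta> \<le> 1"
  shows "v powr \<beta> - u powr \<beta> \<le> (v - u) powr \<beta>"
proof (cases "v = 0")
  case False
  then have v: "0 < v" using assms by linarith
  have sub: "p \<le> p powr \<beta>" if "0 \<le> p" "p \<le> 1" for p :: real
  proof (cases "p = 0")
    case False
    have "p powr 1 \<le> p powr \<beta>" using that assms False by (intro powr_mono') auto
    then show ?thesis using that False by simp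
  qed simp
  have "1 \<le> (u / v) powr \<beta> + ((v - u) / v) powr \<beta>"
  proof -
    have "u / v + (v - u) / v = 1" using v by (simp add: field_simps)
    moreover have "u / v \<le> (u / v) powr \<beta>" "(v - u) / v \<le> ((v - u) / v) powr \<beta>"
      using assms v by (intro sub; simp)+
    ultimately show ?thesis by linarith
  qed
  then have "v powr \<beta> * 1 \<le> v powr \<beta> * ((u / v) powr \<beta> + ((v - u) / v) powr \<beta>)"
    by (intro mult_left_mono) auto
  also have "\<dots> = u powr \<beta> + (v - u) powr \<beta>"
    using assms v by (simp add: powr_divide distrib_left)
  finally show ?thesis by simp
qed (use assms in auto)

lemma powr_diff_le_lipschitz:
  fixes u v \<eta> \<beta> :: real
  assumes "0 < \<eta>" "\<eta> \<le> u" "u \<le> v" "0 < \<beta>" "\<beta> \<le> 1"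
  shows "v powr \<beta> - u powr \<beta> \<le> \<eta> powr (\<beta> - 1) * (v - u)"
proof -
  have u: "0 < u" using assms by linarith
  have "(v / u) powr \<beta> \<le> (v / u) powr 1" using assms u by (intro powr_mono) auto
  then have "u powr \<beta> * (v / u) powr \<beta> \<le> u powr \<beta> * (v / u)" using assms u by (intro mult_left_mono) auto
  then have "v powr \<beta> \<le> u powr \<beta> * (v / u)" using assms u by (simp add: powr_divide)
  then have "v powr \<beta> - u powr \<beta> \<le> u powr \<beta> * (v / u) - u powr \<beta>" by simp
  also have "\<dots> = u powr (\<beta> - 1) * (v - u)" using u by (simp add: powr_diff field_simps)
  also have "\<dots> \<le> \<eta> powr (\<beta> - 1) * (v - u)"
    using assms by (intro mult_right_mono powr_mono2') auto
  finally show ?thesis .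
qed

text \<open>The function splits at height \<open>\<eta>^\<beta> = \<epsilon>/2\<close>. The part below is monotone with range in \<open>[0, \<epsilon>/2]\<close>, so
disjoint intervals contribute at most \<open>\<epsilon>/2\<close> whatever their lengths; the part above is Lipschitz.\<close>

lemma abs_continuous_on_interval_positive_part_powr:
  fixes \<beta> p :: real
  assumes \<beta>: "0 < \<beta>" "\<beta> \<le> 1"
  shows "abs_continuous_on_interval (\<lambda>x. max 0 (x - p) powr \<beta>) a b"
proof (rule abs_continuous_on_intervalI)
  fix \<epsilon> :: real assume \<epsilon>: "0 < \<epsilon>"
  define \<eta> where "\<eta> = (\<epsilon> / 2) powr (1 / \<beta>)"
  have \<eta>: "0 < \<eta>" "\<eta> powr \<beta> = \<epsilon> / 2" using \<epsilon> \<beta> by (auto simp: \<eta>_def powr_powr)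
  define L where "L = \<eta> powr (\<beta> - 1)"
  have L: "0 < L" using \<eta> by (simp add: L_def)
  define f1 f2 where "f1 = (\<lambda>x. min (max 0 (x - p)) \<eta> powr \<beta>)" and "f2 = (\<lambda>x. max (x - p) \<eta> powr \<beta>)"
  have split: "max 0 (x - p) powr \<beta> = f1 x + f2 x - \<eta> powr \<beta>" for x
    using \<eta> by (auto simp: f1_def f2_def min_def max_def)
  have f1: "mono f1" "\<And>x. 0 \<le> f1 x" "\<And>x. f1 x \<le> \<epsilon> / 2"
  proof -
    show "mono f1" unfolding f1_def using \<beta> \<eta> by (intro monoI powr_mono2) auto
    show "f1 x \<le> \<epsilon> / 2" for x unfolding f1_def \<eta>(2)[symmetric] using \<beta> \<eta> by (intro powr_mono2) auto
  qed (auto simp: f1_def)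
  have f2: "\<bar>f2 y - f2 x\<bar> \<le> L * (y - x)" if "x \<le> y" for x y
  proof -
    have "f2 x \<le> f2 y" unfolding f2_def using that \<beta> \<eta> by (intro powr_mono2) auto
    moreover have "f2 y - f2 x \<le> L * (max (y - p) \<eta> - max (x - p) \<eta>)"
      unfolding f2_def L_def using that \<beta> \<eta> by (intro powr_diff_le_lipschitz) auto
    moreover have "L * (max (y - p) \<eta> - max (x - p) \<eta>) \<le> L * (y - x)"
      using that L by (intro mult_left_mono) auto
    ultimately show ?thesis by linarith
  qed
  show "\<exists>\<delta>>0. \<forall>n u v. disjoint_subintervals a b n u v \<longrightarrow>
        (\<Sum>i<n. v i - u i) < \<delta> \<longrightarrow> (\<Sum>i<n. \<bar>max 0 (v i - p) powr \<beta> - max 0 (u i - p) powr \<beta>\<bar>) < \<epsilon>"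
  proof (intro exI[of _ "\<epsilon> / 2 / L"] conjI allI impI)
    fix n and u v :: "nat \<Rightarrow> real"
    assume uv: "disjoint_subintervals a b n u v"
      "(\<Sum>i<n. v i - u i) < \<epsilon> / 2 / L"
    have "(\<Sum>i<n. \<bar>max 0 (v i - p) powr \<beta> - max 0 (u i - p) powr \<beta>\<bar>)
        \<le> (\<Sum>i<n. (f1 (v i) - f1 (u i)) + L * (v i - u i))"
    proof (rule sum_mono)
      fix i assume "i \<in> {..<n}"
      then have "u i \<le> v i" using uv by (auto simp: disjoint_subintervals_def)
      then show "\<bar>max 0 (v i - p) powr \<beta> - max 0 (u i - p) powr \<beta>\<bar> \<le> (f1 (v i) - f1 (u i)) + L * (v i - u i)"
        using f2[of "u i" "v i"] monoD[OF f1(1), of "u i" "v i"] unfolding split by linarith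
    qed
    also have "\<dots> = (\<Sum>i<n. f1 (v i) - f1 (u i)) + L * (\<Sum>i<n. v i - u i)"
      by (simp add: sum.distrib sum_distrib_left)
    also have "\<dots> < \<epsilon> / 2 + L * (\<epsilon> / 2 / L)"
      using uv L by (intro add_le_less_mono mono_increments_le f1 mult_strict_left_mono)
        (auto simp: disjoint_subintervals_def)
    finally show "(\<Sum>i<n. \<bar>max 0 (v i - p) powr \<beta> - max 0 (u i - p) powr \<beta>\<bar>) < \<epsilon>" using L by simp
  qed (use \<epsilon> L in auto)
qed

lemma abs_continuous_on_interval_abs_powr:
  fixes \<beta> p :: real
  assumes \<beta>: "0 < \<beta>" "\<beta> \<le> 1"
  shows "abs_continuous_on_interval (\<lambda>x. \<bar>x - p\<bar> powr \<beta>) a b"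
proof -
  have "abs_continuous_on_interval (\<lambda>x. max 0 (- x - (- p)) powr \<beta>) a b"
    by (rule abs_continuous_on_interval_reflect) (rule abs_continuous_on_interval_positive_part_powr[OF \<beta>])
  from abs_continuous_on_interval_add[OF abs_continuous_on_interval_positive_part_powr[OF \<beta>, of p a b] this]
  show ?thesis
    by (rule abs_continuous_on_interval_cong[rotated]) (auto simp: max_def)
qed

section \<open>Trains of spikes on dyadic blocks\<close>

lemma holder_abs_powr:
  fixes p s t \<beta> :: real
  assumes "0 < \<beta>" "\<beta> \<le> 1"
  shows "\<bar>\<bar>s - p\<bar> powr \<beta> - \<bar>t - p\<bar> powr \<beta>\<bar> \<le> \<bar>s - t\<bar> powr \<beta>"
proof -
  have *: "\<bar>s - p\<bar> powr \<beta> - \<bar>t - p\<bar> powr \<beta> \<le> \<bar>s - t\<bar> powr \<beta>" for s t :: real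
  proof (cases "\<bar>t - p\<bar> \<le> \<bar>s - p\<bar>")
    case True
    have "\<bar>s - p\<bar> powr \<beta> - \<bar>t - p\<bar> powr \<beta> \<le> (\<bar>s - p\<bar> - \<bar>t - p\<bar>) powr \<beta>"
      using True assms by (intro powr_subadditive_diff) auto
    also have "\<dots> \<le> \<bar>s - t\<bar> powr \<beta>" using True assms by (intro powr_mono2) auto
    finally show ?thesis .
  next
    case False
    then have "\<bar>s - p\<bar> powr \<beta> \<le> \<bar>t - p\<bar> powr \<beta>" using assms by (intro powr_mono2) auto
    then show ?thesis using powr_ge_zero[of "\<bar>s - t\<bar>" \<beta>] by linarith
  qed
  show ?thesis using *[of s t] *[of t s] by (simp add: abs_le_iff abs_minus_commute)
qed

lemma J_cases:
  obtains "j = 0" "J j = {-2..<2}"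
  | n where "0 < n" "j = int n" "J j = {2 ^ n..<2 ^ (n + 1)}"
  | n where "0 < n" "j = - int n" "J j = {- (2 ^ (n + 1))..<- (2 ^ n)}"
proof -
  have p: "(2::real) powi (int n + 1) = 2 ^ (n + 1)" for n
    using power_int_of_nat[of "2::real" "n + 1"] by (simp only: of_nat_add of_nat_1)
  show ?thesis
  proof (cases j rule: int_cases3)
    case zero
    then show ?thesis by (intro that(1)) (auto simp: J_def)
  next
    case (pos n)
    then show ?thesis by (intro that(2)[of n]) (auto simp only: J_def p power_int_of_nat split: if_splits)
  next
    case (neg n)
    then show ?thesis by (intro that(3)[of n]) (auto simp only: J_def p power_int_of_nat minus_minus split: if_splits)
  qed
qed

lemma J_abs:
  assumes "x \<in> J j"
  shows "nat \<bar>j\<bar> = 0 \<or> 2 ^ nat \<bar>j\<bar> \<le> \<bar>x\<bar>" "\<bar>x\<bar> \<le> 2 ^ (nat \<bar>j\<bar> + 1)"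
proof -
  have "(nat \<bar>j\<bar> = 0 \<or> 2 ^ nat \<bar>j\<bar> \<le> \<bar>x\<bar>) \<and> \<bar>x\<bar> \<le> 2 ^ (nat \<bar>j\<bar> + 1)"
    using assms by (cases rule: J_cases[of j]) auto
  then show "nat \<bar>j\<bar> = 0 \<or> 2 ^ nat \<bar>j\<bar> \<le> \<bar>x\<bar>" "\<bar>x\<bar> \<le> 2 ^ (nat \<bar>j\<bar> + 1)" by auto
qed

lemma J_memI:
  assumes "2 ^ nat \<bar>j\<bar> < t" "t < 2 ^ (nat \<bar>j\<bar> + 1)"
  shows "(if 0 \<le> j then t else - t) \<in> J j"
  using assms by (cases rule: J_cases[of j]) auto

text \<open>The lower bound on \<open>b * (1 + \<beta>)\<close> makes the spikes narrow enough for integrability; the upper bound on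
\<open>b * \<beta>\<close> keeps them high enough to force decay; \<open>1 < b\<close> keeps neighbouring spikes apart.\<close>

locale spike_train =
  fixes \<beta> b :: real
  assumes \<beta>: "0 < \<beta>" "\<beta> < 1"
    and b: "1 < b" "b * \<beta> < 1" "2 < b * (1 + \<beta>)"
begin

text \<open>The spikes of a block sit at the midpoints of its \<open>n + 1\<close> equal subintervals, so they stay away from
the endpoints of the block.\<close>

definition center :: "nat \<Rightarrow> nat \<Rightarrow> real" where
  "center n m = 2 ^ n * (1 + (real m + 1 / 2) / (real n + 1))"

definition radius :: "nat \<Rightarrow> real" where
  "radius n = 2 ^ n / 2 * (real n + 1) powr (- b)"

text \<open>The Hoelder constant of the \<open>n\<close>-th block; its value makes \<open>2^(-n) * \<kappa>^(1/(1-\<beta>))\<close> equal to \<open>1\<close>.\<close>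

definition steepness :: "nat \<Rightarrow> real" where
  "steepness n = (2 ^ n) powr (1 - \<beta>)"

definition spike :: "nat \<Rightarrow> nat \<Rightarrow> real \<Rightarrow> real" where
  "spike n m t = steepness n * max 0 (radius n powr \<beta> - \<bar>t - center n m\<bar> powr \<beta>)"

definition block :: "nat \<Rightarrow> real \<Rightarrow> real" where
  "block n t = (\<Sum>m\<le>n. spike n m t)"

definition \<Omega> :: "real \<Rightarrow> real" where
  "\<Omega> x = (\<Sum>n. block n \<bar>x\<bar>)"

lemma radius_pos: "0 < radius n" by (simp add: radius_def)

lemma steepness_pos: "0 < steepness n" by (simp add: steepness_def)

lemma radius_le: "radius n \<le> 2 ^ n / (2 * (real n + 1))"
proof -
  have "(real n + 1) powr (- b) \<le> (real n + 1) powr (- 1)" using b by (intro powr_mono) auto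
  then have "2 ^ n / 2 * (real n + 1) powr (- b) \<le> 2 ^ n / 2 * (1 / (real n + 1))"
    by (intro mult_left_mono) (auto simp: powr_minus_divide)
  then show ?thesis by (simp add: radius_def field_simps)
qed

lemma spike_nonneg: "0 \<le> spike n m t"
  using steepness_pos[of n] by (simp add: spike_def)

lemma spike_nonzeroD: "spike n m t \<noteq> 0 \<Longrightarrow> \<bar>t - center n m\<bar> < radius n"
proof (rule ccontr)
  assume nz: "spike n m t \<noteq> 0" and "\<not> \<bar>t - center n m\<bar> < radius n"
  then have "radius n powr \<beta> \<le> \<bar>t - center n m\<bar> powr \<beta>"
    using radius_pos[of n] \<beta> by (intro powr_mono2) auto
  then show False using nz by (simp add: spike_def)
qed

lemma spike_le_peak: "spike n m t \<le> steepness n * radius n powr \<beta>"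
  unfolding spike_def using steepness_pos[of n] by (intro mult_left_mono) auto

lemma center_bounds:
  assumes "m \<le> n"
  shows "2 ^ n + radius n \<le> center n m" "center n m + radius n \<le> 2 ^ (n + 1)"
proof -
  have "2 ^ n * (1 / (2 * (real n + 1))) \<le> 2 ^ n * ((real m + 1 / 2) / (real n + 1))"
    by (intro mult_left_mono) (auto simp: field_simps)
  then show "2 ^ n + radius n \<le> center n m"
    using radius_le[of n] by (simp add: center_def distrib_left)
  have "(real m + 1 / 2) / (real n + 1) + 1 / (2 * (real n + 1)) = (real m + 1) / (real n + 1)"
    by (simp add: divide_simps) (simp add: algebra_simps)
  also have "\<dots> \<le> 1" using assms by simp
  finally have "2 ^ n * ((real m + 1 / 2) / (real n + 1) + 1 / (2 * (real n + 1))) \<le> 2 ^ n * (1::real)"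
    by (intro mult_left_mono) auto
  then show "center n m + radius n \<le> 2 ^ (n + 1)"
    using radius_le[of n] by (simp add: center_def distrib_left)
qed

lemma spike_support:
  assumes "m \<le> n" "spike n m t \<noteq> 0"
  shows "2 ^ n < t" "t < 2 ^ (n + 1)"
  using spike_nonzeroD[OF assms(2)] center_bounds[OF assms(1)] by linarith+

lemma spikes_disjoint:
  assumes "spike n m t \<noteq> 0" "spike n k t \<noteq> 0"
  shows "m = k"
proof (rule ccontr)
  assume "m \<noteq> k"
  then have "1 \<le> \<bar>real m - real k\<bar>" by (cases "m < k") auto
  then have "2 ^ n / (real n + 1) * 1 \<le> 2 ^ n / (real n + 1) * \<bar>real m - real k\<bar>" by (intro mult_left_mono) auto
  also have "2 ^ n / (real n + 1) * \<bar>real m - real k\<bar> = \<bar>2 ^ n / (real n + 1) * (real m - real k)\<bar>"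
    by (simp add: abs_mult)
  also have "2 ^ n / (real n + 1) * (real m - real k) = center n m - center n k"
    by (simp add: center_def diff_divide_distrib add_divide_distrib algebra_simps)
  finally have "2 ^ n / (real n + 1) \<le> \<bar>center n m - center n k\<bar>" by simp
  moreover have "2 * radius n \<le> 2 ^ n / (real n + 1)" using radius_le[of n] by (simp add: field_simps)
  ultimately show False using spike_nonzeroD[OF assms(1)] spike_nonzeroD[OF assms(2)] by linarith
qed

lemma block_nonneg: "0 \<le> block n t"
  unfolding block_def by (intro sum_nonneg spike_nonneg)

lemma spike_le_block: "m \<le> n \<Longrightarrow> spike n m t \<le> block n t"
  unfolding block_def by (intro member_le_sum) (auto simp: spike_nonneg)

lemma block_eq_spike:
  assumes "m \<le> n" "spike n m t \<noteq> 0"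
  shows "block n t = spike n m t"
proof -
  have "block n t = (\<Sum>k\<in>{m}. spike n k t)"
    unfolding block_def
  proof (rule sum.mono_neutral_right)
    show "\<forall>k\<in>{..n} - {m}. spike n k t = 0" using spikes_disjoint[OF assms(2)] by blast
  qed (use assms(1) in auto)
  then show ?thesis by simp
qed

lemma block_cases:
  obtains "block n t = 0" | m where "m \<le> n" "block n t = spike n m t" "spike n m t \<noteq> 0"
proof (cases "\<exists>m\<le>n. spike n m t \<noteq> 0")
  case True
  then obtain m where m: "m \<le> n" "spike n m t \<noteq> 0" by blast
  show ?thesis by (rule that(2)[OF m(1) block_eq_spike[OF m] m(2)])
next
  case False
  then have "block n t = 0" unfolding block_def by (intro sum.neutral) auto
  then show ?thesis by (rule that(1))
qed

lemma block_support:
  assumes "block n t \<noteq> 0"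
  shows "2 ^ n < t" "t < 2 ^ (n + 1)"
proof -
  have "2 ^ n < t \<and> t < 2 ^ (n + 1)"
  proof (cases rule: block_cases[of n t])
    case (2 m)
    then show ?thesis using spike_support by blast
  qed (use assms in simp)
  then show "2 ^ n < t" "t < 2 ^ (n + 1)" by auto
qed

lemma block_eq_0_below: "block n t = 0" if "t \<le> 2 ^ n" using block_support(1)[of n t] that by linarith

lemma \<Omega>_eq_sum:
  assumes "\<bar>x\<bar> \<le> 2 ^ N"
  shows "\<Omega> x = (\<Sum>n<N. block n \<bar>x\<bar>)"
  unfolding \<Omega>_def
proof (rule suminf_finite)
  fix n assume "n \<notin> {..<N}"
  then have "(2::real) ^ N \<le> 2 ^ n" by (intro power_increasing) auto
  then show "block n \<bar>x\<bar> = 0" using assms by (intro block_eq_0_below) linarith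
qed simp

lemma \<Omega>_eq_block:
  assumes "n = 0 \<or> 2 ^ n \<le> \<bar>x\<bar>" "\<bar>x\<bar> \<le> 2 ^ (n + 1)"
  shows "\<Omega> x = block n \<bar>x\<bar>"
proof -
  have "\<Omega> x = (\<Sum>k<n + 1. block k \<bar>x\<bar>)" using assms(2) by (rule \<Omega>_eq_sum)
  also have "\<dots> = (\<Sum>k\<in>{n}. block k \<bar>x\<bar>)"
  proof (rule sum.mono_neutral_right)
    show "\<forall>k\<in>{..<n + 1} - {n}. block k \<bar>x\<bar> = 0"
    proof
      fix k assume "k \<in> {..<n + 1} - {n}"
      then have k: "k < n" by auto
      then have "(2::real) ^ (k + 1) \<le> 2 ^ n" by (intro power_increasing) auto
      then show "block k \<bar>x\<bar> = 0" using block_support(2)[of k "\<bar>x\<bar>"] assms(1) k by auto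
    qed
  qed auto
  finally show ?thesis by simp
qed

lemma \<Omega>_nonneg: "0 \<le> \<Omega> x"
proof -
  obtain N where "\<bar>x\<bar> < 2 ^ N" using real_arch_pow[of 2 "\<bar>x\<bar>"] by auto
  then show ?thesis using \<Omega>_eq_sum[of x N] by (simp add: sum_nonneg block_nonneg)
qed

lemma spike_holder: "\<bar>spike n m s - spike n m t\<bar> \<le> steepness n * \<bar>s - t\<bar> powr \<beta>"
proof -
  have "\<bar>max 0 (radius n powr \<beta> - \<bar>s - center n m\<bar> powr \<beta>) - max 0 (radius n powr \<beta> - \<bar>t - center n m\<bar> powr \<beta>)\<bar>
      \<le> \<bar>s - t\<bar> powr \<beta>"
  proof -
    have "\<bar>max 0 (r - p) - max 0 (r - q)\<bar> \<le> \<bar>p - q\<bar>" for r p q :: real by (auto simp: max_def)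
    from order_trans[OF this holder_abs_powr] show ?thesis using \<beta> by auto
  qed
  then have "steepness n * \<bar>max 0 (radius n powr \<beta> - \<bar>s - center n m\<bar> powr \<beta>) - max 0 (radius n powr \<beta> - \<bar>t - center n m\<bar> powr \<beta>)\<bar>
      \<le> steepness n * \<bar>s - t\<bar> powr \<beta>"
    using steepness_pos[of n] by (intro mult_left_mono) auto
  moreover have "\<bar>spike n m s - spike n m t\<bar> = steepness n * \<bar>max 0 (radius n powr \<beta> - \<bar>s - center n m\<bar> powr \<beta>) - max 0 (radius n powr \<beta> - \<bar>t - center n m\<bar> powr \<beta>)\<bar>"
    unfolding spike_def right_diff_distrib[symmetric] abs_mult using steepness_pos[of n] by simp
  ultimately show ?thesis by simp
qed

text \<open>Where the block function is nonzero it coincides with a single spike, and everywhere it dominates each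
of its spikes. So its increments are bounded by those of one spike, without a factor for their number.\<close>

lemma block_holder: "\<bar>block n s - block n t\<bar> \<le> steepness n * \<bar>s - t\<bar> powr \<beta>"
proof -
  have *: "block n s - block n t \<le> steepness n * \<bar>s - t\<bar> powr \<beta>" for s t
  proof (cases rule: block_cases[of n s])
    case 1
    moreover have "0 \<le> steepness n * \<bar>s - t\<bar> powr \<beta>" using steepness_pos[of n] by simp
    ultimately show ?thesis using block_nonneg[of n t] by linarith
  next
    case (2 m)
    \<comment> \<open>The spike that is active at s is a lower bound for the block function at t.\<close>
    then show ?thesis using spike_holder[of n m s t] spike_le_block[of m n t] by linarith
  qed
  show ?thesis using *[of s t] *[of t s] by (simp add: abs_le_iff abs_minus_commute)
qed

text \<open>The constant is attained between the tip of a spike and a point on its flank.\<close>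

lemma \<Omega>_least_holder_const: "least_holder_const \<beta> \<Omega> (J j) (steepness (nat \<bar>j\<bar>))"
  unfolding least_holder_const_def
proof (intro conjI allI impI)
  let ?n = "nat \<bar>j\<bar>"
  have eq: "\<Omega> x = block ?n \<bar>x\<bar>" if "x \<in> J j" for x
    using J_abs[OF that] by (rule \<Omega>_eq_block)
  show "holder_bound \<beta> \<Omega> (J j) (steepness ?n)"
    unfolding holder_bound_def
  proof (intro ballI)
    fix x y assume xy: "x \<in> J j" "y \<in> J j"
    have "\<bar>block ?n \<bar>x\<bar> - block ?n \<bar>y\<bar>\<bar> \<le> steepness ?n * \<bar>\<bar>x\<bar> - \<bar>y\<bar>\<bar> powr \<beta>" by (rule block_holder)
    also have "\<dots> \<le> steepness ?n * \<bar>x - y\<bar> powr \<beta>"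
      using steepness_pos[of ?n] \<beta> by (intro mult_left_mono powr_mono2) auto
    finally show "\<bar>\<Omega> x - \<Omega> y\<bar> \<le> steepness ?n * \<bar>x - y\<bar> powr \<beta>" using xy by (simp add: eq)
  qed
  fix K assume K: "holder_bound \<beta> \<Omega> (J j) K"
  define p where "p = center ?n 0"
  define r where "r = radius ?n"
  \<comment> \<open>The point at half the radius keeps clear of the endpoints of the block, not all of which belong to J j.\<close>
  define q where "q = p - r / 2"
  define sg :: "real \<Rightarrow> real" where "sg = (\<lambda>t. if 0 \<le> j then t else - t)"
  have r: "0 < r" by (simp add: r_def radius_pos)
  have pq: "2 ^ ?n < p" "p < 2 ^ (?n + 1)" "2 ^ ?n < q" "q < 2 ^ (?n + 1)"
    using center_bounds[of 0 ?n] r by (auto simp: p_def q_def r_def)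
  have mem: "sg p \<in> J j" "sg q \<in> J j" unfolding sg_def by (rule J_memI[OF pq(1,2)], rule J_memI[OF pq(3,4)])
  have pos: "0 < p" "0 < q" using pq(1,3) by (smt (verit) zero_less_power)+
  have abs: "\<bar>sg p\<bar> = p" "\<bar>sg q\<bar> = q" "\<bar>sg p - sg q\<bar> = r / 2"
    using pos r by (auto simp: sg_def q_def)
  have r2: "(r / 2) powr \<beta> < r powr \<beta>" using r \<beta> by (intro powr_less_mono2) auto
  have sp: "spike ?n 0 p = steepness ?n * r powr \<beta>" by (simp add: spike_def p_def r_def)
  have sq: "spike ?n 0 q = steepness ?n * (r powr \<beta> - (r / 2) powr \<beta>)"
    using r2 r by (simp add: spike_def q_def p_def[symmetric] r_def[symmetric])
  have "block ?n p = spike ?n 0 p" "block ?n q = spike ?n 0 q"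
    using r r2 steepness_pos[of ?n] by (intro block_eq_spike; simp add: sp sq)+
  then have "\<Omega> (sg p) - \<Omega> (sg q) = steepness ?n * (r / 2) powr \<beta>"
    by (simp add: eq[OF mem(1)] eq[OF mem(2)] abs sp sq right_diff_distrib)
  moreover have "\<bar>\<Omega> (sg p) - \<Omega> (sg q)\<bar> \<le> K * (r / 2) powr \<beta>"
    using K mem unfolding holder_bound_def by (metis abs(3))
  ultimately have "steepness ?n * (r / 2) powr \<beta> \<le> K * (r / 2) powr \<beta>" by linarith
  then show "steepness ?n \<le> K" using r by simp
qed

text \<open>On a bounded interval only finitely many spikes matter, and evenness is expressed by adding to each
spike its mirror image.\<close>

lemma \<Omega>_abs_continuous: "abs_continuous_on_interval \<Omega> u v"
proof -
  have spike_ac: "abs_continuous_on_interval (spike n m) u v" for n m u v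
    unfolding spike_def
  proof (rule abs_continuous_on_interval_lipschitz_comp[OF abs_continuous_on_interval_abs_powr])
    show "\<bar>steepness n * max 0 (radius n powr \<beta> - s) - steepness n * max 0 (radius n powr \<beta> - t)\<bar> \<le> steepness n * \<bar>s - t\<bar>" for s t
      unfolding right_diff_distrib[symmetric] abs_mult using steepness_pos[of n] by (simp add: mult_left_mono)
  qed (use \<beta> steepness_pos in auto)
  obtain N where "max \<bar>u\<bar> \<bar>v\<bar> < 2 ^ N" using real_arch_pow[of 2 "max \<bar>u\<bar> \<bar>v\<bar>"] by auto
  then have eq: "(\<Sum>n<N. \<Sum>m\<le>n. spike n m x + spike n m (- x)) = \<Omega> x" if "u \<le> x" "x \<le> v" for x
  proof -
    have neg: "spike n m t = 0" if "m \<le> n" "t \<le> 0" for n m t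
    proof (rule ccontr)
      assume "spike n m t \<noteq> 0"
      then have "2 ^ n < t" using that by (intro spike_support)
      then show False using that by (smt (verit) zero_less_power)
    qed
    have "spike n m x + spike n m (- x) = spike n m \<bar>x\<bar>" if "m \<le> n" for n m
      using neg[OF that, of x] neg[OF that, of "- x"] by (cases "0 \<le> x") auto
    then have "(\<Sum>n<N. \<Sum>m\<le>n. spike n m x + spike n m (- x)) = (\<Sum>n<N. block n \<bar>x\<bar>)"
      by (simp add: block_def)
    also have "\<dots> = \<Omega> x" using that \<open>max \<bar>u\<bar> \<bar>v\<bar> < 2 ^ N\<close> by (intro \<Omega>_eq_sum[symmetric]) auto
    finally show ?thesis .
  qed
  show ?thesis
    by (rule abs_continuous_on_interval_cong[OF eq])
       (auto intro!: abs_continuous_on_interval_sum abs_continuous_on_interval_add spike_ac abs_continuous_on_interval_reflect)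
qed

lemma block_continuous: "continuous_on UNIV (block n)"
proof -
  have "continuous_on UNIV (\<lambda>t. \<bar>t - center n m\<bar> powr \<beta>)" for m
    using \<beta> by (intro continuous_on_powr' continuous_intros) auto
  then show ?thesis unfolding block_def spike_def
    by (intro continuous_on_sum continuous_on_mult continuous_on_max continuous_on_diff continuous_on_const)
qed

lemma \<Omega>_continuous: "continuous_on UNIV \<Omega>"
proof -
  have "isCont \<Omega> x" for x
  proof -
    obtain N where N: "\<bar>x\<bar> < 2 ^ N" using real_arch_pow[of 2 "\<bar>x\<bar>"] by auto
    have "continuous_on {- (2 ^ N)<..<2 ^ N} (\<lambda>x. \<Sum>n<N. block n \<bar>x\<bar>)"
      by (intro continuous_intros continuous_on_compose2[OF block_continuous]) auto
    then have "continuous_on {- (2 ^ N)<..<2 ^ N} \<Omega>"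
      by (rule continuous_on_eq) (auto intro!: \<Omega>_eq_sum[symmetric])
    then show ?thesis using N by (subst (asm) continuous_on_eq_continuous_at) (auto simp: abs_less_iff)
  qed
  then show ?thesis by (simp add: continuous_on_eq_continuous_at)
qed

text \<open>Each spike is bounded by its height on its support, where \<open>1 + x^2 \<ge> 4^n\<close>. With \<open>n + 1\<close> spikes and
their mirror images the block contributes at most
\<open>4 * (n+1) * K * r^(1+\<beta>) / 4^n \<le> 4 * (n+1)^(1 - b*(1+\<beta>))\<close>.\<close>

lemma \<Omega>_integrable: "integrable lborel (\<lambda>x. 1 / (1 + x\<^sup>2) * \<Omega> x)"
proof -
  have [measurable]: "block n \<in> borel_measurable borel" for n
    by (rule borel_measurable_continuous_onI[OF block_continuous])
  have sq4: "(2 ^ n)\<^sup>2 = (4 :: real) ^ n" for n :: nat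
    using power_mult[of "2::real" 2 n] power_mult[of "2::real" n 2] by (simp add: mult.commute)
  define f where "f = (\<lambda>n x. 1 / (1 + x\<^sup>2) * block n \<bar>x\<bar>)"
  have f0: "0 \<le> f n x" for n x by (simp add: f_def block_nonneg)
  have [measurable]: "f n \<in> borel_measurable borel" for n unfolding f_def by measurable
  define D where "D = (\<lambda>n m. indicat_real {center n m - radius n..center n m + radius n})"
  define c where "c = (\<lambda>n. steepness n * radius n powr \<beta> / 4 ^ n)"
  define g where "g = (\<lambda>n x. c n * (\<Sum>m\<le>n. D n m x + D n m (- x)))"
  have c0: "0 \<le> c n" for n using steepness_pos[of n] by (simp add: c_def)
  have fg: "f n x \<le> g n x" for n x
  proof (cases rule: block_cases[of n "\<bar>x\<bar>"])
    case 1
    then show ?thesis using c0 by (auto simp: f_def g_def D_def intro!: mult_nonneg_nonneg sum_nonneg)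
  next
    case (2 m)
    have "\<bar>\<bar>x\<bar> - center n m\<bar> < radius n" using 2(3) by (rule spike_nonzeroD)
    then have "1 \<le> D n m x + D n m (- x)" by (cases "0 \<le> x") (auto simp: D_def indicator_def)
    also have "\<dots> \<le> (\<Sum>m\<le>n. D n m x + D n m (- x))"
      using 2(1) by (intro member_le_sum) (auto simp: D_def)
    finally have "c n * 1 \<le> g n x" unfolding g_def using c0 by (intro mult_left_mono) auto
    moreover have "f n x \<le> c n"
    proof -
      have "2 ^ n < \<bar>x\<bar>" using 2 by (intro spike_support)
      then have "(2 ^ n)\<^sup>2 \<le> \<bar>x\<bar>\<^sup>2" by (intro power_mono) auto
      then have "4 ^ n \<le> 1 + x\<^sup>2" unfolding sq4 power2_abs by linarith
      then have "1 / (1 + x\<^sup>2) * block n \<bar>x\<bar> \<le> 1 / 4 ^ n * (steepness n * radius n powr \<beta>)"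
        using 2 spike_le_peak[of n m "\<bar>x\<bar>"] spike_nonneg
        by (intro mult_mono divide_left_mono) (auto intro!: mult_pos_pos add_pos_nonneg)
      then show ?thesis by (simp add: f_def c_def)
    qed
    ultimately show ?thesis by simp
  qed
  have D: "integrable lborel (D n m)" "integral\<^sup>L lborel (D n m) = 2 * radius n" for n m
    using radius_pos[of n] by (auto simp: D_def emeasure_lborel_Icc_eq)
  have D': "integrable lborel (\<lambda>x. D n m (- x))" "(LINT x|lborel. D n m (- x)) = 2 * radius n" for n m
    using lborel_integrable_real_affine[OF D(1)[of n m], of "-1" 0] lborel_integral_real_affine[of "-1" "D n m" 0] D(2)[of n m] by auto
  have gi: "integrable lborel (g n)" for n
    unfolding g_def by (intro integrable_mult_right Bochner_Integration.integrable_sum Bochner_Integration.integrable_add D D')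
  have gI: "integral\<^sup>L lborel (g n) = c n * ((real n + 1) * (4 * radius n))" for n
  proof -
    have "integral\<^sup>L lborel (g n) = c n * (\<Sum>m\<le>n. LINT x|lborel. D n m x + D n m (- x))"
      unfolding g_def by (simp add: Bochner_Integration.integral_sum D D')
    also have "(\<Sum>m\<le>n. LINT x|lborel. D n m x + D n m (- x)) = (\<Sum>m\<le>n. 4 * radius n)"
      using D D' by (intro sum.cong refl) simp
    finally show ?thesis by simp
  qed
  have fi: "integrable lborel (f n)" for n
  proof (rule Bochner_Integration.integrable_bound[OF gi[of n]])
    show "AE x in lborel. norm (f n x) \<le> norm (g n x)"
      using f0[of n] order_trans[OF fg[of n] abs_ge_self] by (intro AE_I2) simp
  qed measurable
  have fI: "(LINT x|lborel. norm (f n x)) \<le> 4 * (real n + 1) powr (1 - b * (1 + \<beta>))" for n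
  proof -
    have "(LINT x|lborel. norm (f n x)) \<le> integral\<^sup>L lborel (g n)"
      using fi gi fg f0 by (intro integral_mono) auto
    also have "\<dots> = 4 * (steepness n * (radius n powr \<beta> * radius n) / 4 ^ n * (real n + 1))" by (simp add: gI c_def)
    also have "radius n powr \<beta> * radius n = radius n powr (1 + \<beta>)"
      using radius_pos[of n] by (simp add: powr_add)
    also have "steepness n * radius n powr (1 + \<beta>) / 4 ^ n \<le> (real n + 1) powr (- b * (1 + \<beta>))"
    proof -
      have "radius n powr (1 + \<beta>) \<le> (2 ^ n * (real n + 1) powr (- b)) powr (1 + \<beta>)"
        using radius_pos[of n] \<beta> by (intro powr_mono2) (auto simp: radius_def)
      also have "\<dots> = (2 ^ n) powr (1 + \<beta>) * (real n + 1) powr (- b * (1 + \<beta>))"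
        by (simp add: powr_mult powr_powr)
      finally have "steepness n * radius n powr (1 + \<beta>) \<le> steepness n * ((2 ^ n) powr (1 + \<beta>) * (real n + 1) powr (- b * (1 + \<beta>)))"
        using steepness_pos[of n] by (intro mult_left_mono) auto
      also have "\<dots> = (2 ^ n) powr (1 - \<beta> + (1 + \<beta>)) * (real n + 1) powr (- b * (1 + \<beta>))"
        by (simp only: steepness_def powr_add mult.assoc)
      also have "(2 ^ n :: real) powr (1 - \<beta> + (1 + \<beta>)) = 4 ^ n"
        using sq4[of n] by simp
      finally show ?thesis by (simp add: divide_le_eq mult.commute)
    qed
    then have "4 * (steepness n * radius n powr (1 + \<beta>) / 4 ^ n * (real n + 1)) \<le> 4 * ((real n + 1) powr (- b * (1 + \<beta>)) * (real n + 1))"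
      by (intro mult_left_mono mult_right_mono) auto
    also have "(real n + 1) powr (- b * (1 + \<beta>)) * (real n + 1) = (real n + 1) powr (1 - b * (1 + \<beta>))"
      using powr_add[of "real n + 1" "- b * (1 + \<beta>)" 1] by (simp add: add.commute)
    finally show ?thesis .
  qed
  have "summable (\<lambda>n. real (Suc n) powr (1 - b * (1 + \<beta>)))"
    using b(3) by (subst summable_Suc_iff, subst summable_real_powr_iff) auto
  then have "summable (\<lambda>n. 4 * (real n + 1) powr (1 - b * (1 + \<beta>)))"
    by (intro summable_mult) (simp add: add.commute)
  then have sI: "summable (\<lambda>n. LINT x|lborel. norm (f n x))"
    by (rule summable_comparison_test'[of _ 0]) (use fI in auto)
  have fin: "finite {n. f n x \<noteq> 0}" for x
  proof -
    obtain N where N: "\<bar>x\<bar> < 2 ^ N" using real_arch_pow[of 2 "\<bar>x\<bar>"] by auto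
    have "n < N" if "f n x \<noteq> 0" for n
    proof (rule ccontr)
      assume "\<not> n < N"
      then have "(2::real) ^ N \<le> 2 ^ n" by (intro power_increasing) auto
      then have "block n \<bar>x\<bar> = 0" using N by (intro block_eq_0_below) linarith
      then show False using that by (simp add: f_def)
    qed
    then have "{n. f n x \<noteq> 0} \<subseteq> {..<N}" by blast
    then show ?thesis by (rule finite_subset) simp
  qed
  have "integrable lborel (\<lambda>x. \<Sum>n. f n x)"
  proof (rule integrable_suminf[OF fi _ sI])
    have "summable (\<lambda>n. norm (f n x))" for x
      by (rule summable_finite[OF fin[of x]]) auto
    then show "AE x in lborel. summable (\<lambda>n. norm (f n x))" by simp
  qed
  moreover have "(\<Sum>n. f n x) = 1 / (1 + x\<^sup>2) * \<Omega> x" for x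
  proof -
    obtain N where N: "\<bar>x\<bar> < 2 ^ N" using real_arch_pow[of 2 "\<bar>x\<bar>"] by auto
    have "(\<Sum>n. f n x) = (\<Sum>n<N. f n x)"
    proof (rule suminf_finite)
      fix n assume "n \<notin> {..<N}"
      then have "(2::real) ^ N \<le> 2 ^ n" by (intro power_increasing) auto
      then have "block n \<bar>x\<bar> = 0" using N by (intro block_eq_0_below) linarith
      then show "f n x = 0" by (simp add: f_def)
    qed simp
    then show ?thesis using \<Omega>_eq_sum[of x N] N by (simp add: f_def sum_distrib_left)
  qed
  ultimately show ?thesis by simp
qed

section \<open>Decay forced by the spikes\<close>

lemma near_center:
  assumes "2 ^ n \<le> x" "x \<le> 2 ^ (n + 1)"
  obtains m where "m \<le> n" "\<bar>x - center n m\<bar> \<le> 2 ^ n / (2 * (real n + 1))"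
proof -
  define y where "y = (x / 2 ^ n - 1) * (real n + 1)"
  have "1 \<le> x / 2 ^ n" "x / 2 ^ n \<le> 2" using assms by (auto simp: field_simps)
  then have y: "0 \<le> y" "y \<le> real n + 1"
    using mult_right_mono[of "x / 2 ^ n - 1" 1 "real n + 1"] by (auto simp: y_def)
  define m where "m = min n (nat \<lfloor>y\<rfloor>)"
  have m: "\<bar>y - (real m + 1 / 2)\<bar> \<le> 1 / 2"
  proof (cases "nat \<lfloor>y\<rfloor> \<le> n")
    case True
    then have "real m = of_int \<lfloor>y\<rfloor>" using y(1) by (simp add: m_def)
    then show ?thesis by linarith
  next
    case False
    then have "real n + 1 \<le> y" using y(1) by linarith
    then show ?thesis using False y(2) by (simp add: m_def)
  qed
  have "x - center n m = 2 ^ n / (real n + 1) * (y - (real m + 1 / 2))"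
  proof -
    have "P / K * ((x / P - 1) * K - h) = x - P * (1 + h / K)" if "P \<noteq> 0" "K \<noteq> 0" for P K h :: real
      using that by (simp add: field_simps)
    then show ?thesis unfolding y_def center_def by simp
  qed
  then have "\<bar>x - center n m\<bar> = 2 ^ n / (real n + 1) * \<bar>y - (real m + 1 / 2)\<bar>"
    by (simp add: abs_mult)
  also have "\<dots> \<le> 2 ^ n / (real n + 1) * (1 / 2)" using m by (intro mult_left_mono) auto
  also have "\<dots> = 2 ^ n / (2 * (real n + 1))" by simp
  finally have "\<bar>x - center n m\<bar> \<le> 2 ^ n / (2 * (real n + 1))" .
  then show ?thesis using that[of m] by (simp add: m_def)
qed

text \<open>At this distance from its centre a spike has dropped to half its height.\<close>

definition dip_radius :: "nat \<Rightarrow> real" where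
  "dip_radius n = radius n * 2 powr (- 1 / \<beta>)"

definition dip_depth :: "nat \<Rightarrow> real" where
  "dip_depth n = 2 ^ n / 4 * (real n + 1) powr (- b * \<beta>)"

lemma dip_radius: "0 < dip_radius n" "dip_radius n \<le> radius n" "dip_radius n powr \<beta> = radius n powr \<beta> / 2"
proof -
  show "0 < dip_radius n" using radius_pos[of n] by (simp add: dip_radius_def)
  have "2 powr (- 1 / \<beta>) \<le> 2 powr 0" using \<beta> by (intro powr_mono) auto
  then show "dip_radius n \<le> radius n" using radius_pos[of n] by (simp add: dip_radius_def mult_left_le)
  show "dip_radius n powr \<beta> = radius n powr \<beta> / 2"
    using radius_pos[of n] \<beta> by (simp add: dip_radius_def powr_mult powr_divide powr_powr powr_minus_divide)
qed

lemma \<Omega>_ge_dip_depth: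
  assumes m: "m \<le> n" and y: "\<bar>y - center n m\<bar> \<le> dip_radius n"
  shows "dip_depth n \<le> \<Omega> y"
proof -
  have yb: "2 ^ n \<le> y" "y \<le> 2 ^ (n + 1)" using center_bounds[OF m] y dip_radius(2)[of n] by linarith+
  then have y0: "\<bar>y\<bar> = y" by (smt (verit) zero_less_power)
  have "\<bar>y - center n m\<bar> powr \<beta> \<le> dip_radius n powr \<beta>" using y \<beta> by (intro powr_mono2) auto
  then have d: "radius n powr \<beta> / 2 \<le> radius n powr \<beta> - \<bar>y - center n m\<bar> powr \<beta>" by (simp add: dip_radius)
  have "steepness n * (radius n powr \<beta> / 2) \<le> spike n m y"
    unfolding spike_def using order_trans[OF d max.cobounded2] steepness_pos[of n] by (intro mult_left_mono) auto
  also have "\<dots> \<le> block n y" by (rule spike_le_block[OF m])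
  also have "\<dots> = \<Omega> y" using \<Omega>_eq_block[of n y] yb by (simp add: y0)
  finally have 1: "steepness n * (radius n powr \<beta> / 2) \<le> \<Omega> y" .
  have "radius n powr \<beta> = (2 ^ n) powr \<beta> * (real n + 1) powr (- b * \<beta>) / 2 powr \<beta>"
    by (simp add: radius_def powr_mult powr_divide powr_powr)
  also have "\<dots> \<ge> (2 ^ n) powr \<beta> * (real n + 1) powr (- b * \<beta>) / 2"
    using \<beta> powr_mono[of \<beta> 1 "2::real"] by (intro divide_left_mono) auto
  finally have "steepness n * ((2 ^ n) powr \<beta> * (real n + 1) powr (- b * \<beta>) / 2 / 2) \<le> steepness n * (radius n powr \<beta> / 2)"
    using steepness_pos[of n] by (intro mult_left_mono divide_right_mono) auto
  moreover have "steepness n * ((2 ^ n) powr \<beta> * (real n + 1) powr (- b * \<beta>) / 2 / 2) = dip_depth n"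
    using powr_add[of "2 ^ n :: real" "1 - \<beta>" \<beta>] by (simp add: steepness_def dip_depth_def)
  ultimately show ?thesis using 1 by linarith
qed

text \<open>The logarithm is \<open>O(ln n)\<close> because the ratio of the half spacing to the radius is a constant
times a power of \<open>n + 1\<close>.
After division by \<open>2^n / (n+1)\<close> the claim compares \<open>ln n\<close> with \<open>n^(1 - b*\<beta>)\<close>.\<close>

lemma dips_deep_enough:
  "\<forall>\<^sub>F n in sequentially. 5 * 2 ^ n / (real n + 1) * ln (2 * exp 1 * (2 ^ n / (2 * (real n + 1))) / dip_radius n) \<le> dip_depth n"
proof -
  define \<gamma> where "\<gamma> = 1 - b * \<beta>"
  have \<gamma>: "0 < \<gamma>" using b by (simp add: \<gamma>_def)
  define c where "c = ln (2 * exp 1 * 2 powr (1 / \<beta>))"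
  define d where "d = b - 1"
  have "\<forall>\<^sub>F n in sequentially. 20 * (c + d * ln (real n + 1)) \<le> (real n + 1) powr \<gamma>"
    using \<gamma> by real_asymp
  then show ?thesis
  proof eventually_elim
    case (elim n)
    define N where "N = real n + 1"
    have N: "1 \<le> N" by (simp add: N_def)
    have ratio: "2 * exp 1 * (2 ^ n / (2 * N)) / dip_radius n = 2 * exp 1 * 2 powr (1 / \<beta>) * N powr d"
    proof -
      have dip: "dip_radius n = 2 ^ n / 2 / (N powr b * 2 powr (1 / \<beta>))"
        unfolding dip_radius_def radius_def N_def[symmetric] by (simp add: powr_minus_divide)
      have pd: "N powr d = N powr b / N" using N by (simp add: d_def powr_diff)
      show ?thesis unfolding dip pd using N by (simp add: field_simps)
    qed
    have "ln (2 * exp 1 * 2 powr (1 / \<beta>) * N powr d) = c + d * ln N"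
      unfolding c_def using N by (subst ln_mult) (auto simp: ln_powr)
    then have "5 * 2 ^ n / N * ln (2 * exp 1 * (2 ^ n / (2 * N)) / dip_radius n) = 5 * 2 ^ n / N * (c + d * ln N)"
      unfolding ratio by simp
    also have "\<dots> = 2 ^ n / 4 / N * (20 * (c + d * ln N))"
      using N by (simp add: field_simps)
    also have "\<dots> \<le> 2 ^ n / 4 / N * N powr \<gamma>" using elim N by (intro mult_left_mono) (auto simp: N_def)
    also have "\<dots> = dip_depth n"
      unfolding dip_depth_def \<gamma>_def N_def[symmetric] using N by (simp add: powr_diff powr_minus field_simps)
    finally show ?case by (simp add: N_def)
  qed
qed

text \<open>With \<open>D = 2^n / (n+1)\<close> the half spacing is \<open>D/2\<close>, and within \<open>6 * D/2 = 3*D\<close> of the line \<open>g\<close> is at most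
\<open>C * exp (3*D)\<close>. Choosing \<open>k \<ge> 4*D\<close> leaves \<open>exp (3*D - k) \<le> exp (- D)\<close>, and \<open>k \<le> 5*D\<close> is affordable by
\<open>dips_deep_enough\<close>.\<close>

lemma decay_on_dyadic_blocks:
  fixes g :: "complex \<Rightarrow> complex"
  assumes hol: "g holomorphic_on UNIV" and C: "1 \<le> C"
    and growth: "\<And>z. cmod (g z) \<le> C * exp (max 0 (- Im z))"
    and small: "\<And>x. cmod (g (of_real x)) \<le> exp (- \<Omega> x)"
  obtains n0 where "\<And>n x. n0 \<le> n \<Longrightarrow> 2 ^ n \<le> x \<Longrightarrow> x \<le> 2 ^ (n + 1) \<Longrightarrow>
    cmod (g (of_real x)) \<le> C * exp (- (2 ^ n / (real n + 1)))"
proof -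
  obtain n0 where n0: "\<And>n. n0 \<le> n \<Longrightarrow> 5 * 2 ^ n / (real n + 1) * ln (2 * exp 1 * (2 ^ n / (2 * (real n + 1))) / dip_radius n) \<le> dip_depth n"
    using dips_deep_enough by (auto simp: eventually_sequentially)
  show ?thesis
  proof (rule that)
    fix n :: nat and x :: real assume n: "n0 \<le> n" and x: "2 ^ n \<le> x" "x \<le> 2 ^ (n + 1)"
    define D where "D = 2 ^ n / (real n + 1)"
    define s where "s = 2 ^ n / (2 * (real n + 1))"
    have D1: "1 \<le> D"
    proof -
      have "n < 2 ^ n" by (rule less_exp)
      then have "real (n + 1) \<le> real (2 ^ n)" by (simp only: of_nat_le_iff)
      then show ?thesis by (simp add: D_def)
    qed
    have sD: "s = D / 2" by (simp add: s_def D_def)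
    define \<eta> where "\<eta> = dip_radius n"
    have \<eta>: "0 < \<eta>" "\<eta> \<le> s" using dip_radius[of n] radius_le[of n] by (auto simp: \<eta>_def s_def)
    define \<rho> where "\<rho> = 2 * exp 1 * s / \<eta>"
    have \<rho>: "1 \<le> \<rho>"
    proof -
      have "\<eta> * 1 \<le> s * (2 * exp 1)" using \<eta> exp_ge_add_one_self[of 1] by (intro mult_mono) auto
      then show ?thesis using \<eta> by (simp add: \<rho>_def field_simps)
    qed
    define k where "k = nat \<lceil>4 * D\<rceil>"
    have k: "4 * D \<le> real k" "real k \<le> 5 * D" using D1 unfolding k_def by linarith+
    have kH: "real k * ln \<rho> \<le> dip_depth n"
    proof -
      have "real k * ln \<rho> \<le> 5 * D * ln \<rho>" using k \<rho> by (intro mult_right_mono) auto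
      also have "\<dots> \<le> dip_depth n" using n0[OF n] by (simp add: D_def \<rho>_def s_def \<eta>_def)
      finally show ?thesis .
    qed
    obtain m where m: "m \<le> n" "\<bar>x - center n m\<bar> \<le> s" using near_center[OF x] by (auto simp: s_def)
    have "cmod (g (of_real x)) \<le> C * exp (6 * s) * exp (- real k)"
    proof (rule decay_near_dip[OF hol \<eta> _ _ _ m(2)])
      fix y assume "\<bar>y - center n m\<bar> \<le> \<eta>"
      then have "dip_depth n \<le> \<Omega> y" using m(1) by (intro \<Omega>_ge_dip_depth) (auto simp: \<eta>_def)
      then show "cmod (g (of_real y)) \<le> exp (- dip_depth n)" using small[of y] by (smt (verit) exp_le_cancel_iff)
    next
      fix z assume z: "cmod (z - of_real (center n m)) \<le> 2 * exp 1 * s"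
      \<comment> \<open>Only the lower half-plane allows growth, and exp 1 is at most 3.\<close>
      have "- Im z \<le> cmod (z - of_real (center n m))" using abs_Im_le_cmod[of "z - of_real (center n m)"] by simp
      also have "\<dots> \<le> exp 1 * (2 * s)" using z by simp
      also have "\<dots> \<le> 3 * (2 * s)" using exp_le \<eta> by (intro mult_right_mono) auto
      also have "\<dots> = 6 * s" by simp
      finally have "max 0 (- Im z) \<le> 6 * s" using \<eta> by simp
      then show "cmod (g z) \<le> C * exp (6 * s)"
        using growth[of z] C by (smt (verit) exp_le_cancel_iff mult_left_mono)
    next
      have "exp (- dip_depth n) \<le> exp (- (real k * ln \<rho>))" using kH by simp
      also have "\<dots> = 1 / \<rho> ^ k" using \<rho> by (simp add: exp_minus exp_of_nat_mult field_simps)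
      also have "\<dots> \<le> C * exp (6 * s) / \<rho> ^ k"
      proof (rule divide_right_mono)
        have "1 * 1 \<le> C * exp (6 * s)" using C \<eta> by (intro mult_mono) auto
        then show "1 \<le> C * exp (6 * s)" by simp
      qed (use \<rho> in auto)
      finally show "exp (- dip_depth n) \<le> C * exp (6 * s) / (2 * exp 1 * s / \<eta>) ^ k" by (simp add: \<rho>_def)
    qed
    also have "\<dots> = C * exp (6 * s - real k)" by (simp add: exp_add[symmetric])
    also have "\<dots> \<le> C * exp (- D)" using k sD C by (intro mult_left_mono) auto
    finally show "cmod (g (of_real x)) \<le> C * exp (- (2 ^ n / (real n + 1)))" by (simp add: D_def)
  qed
qed

text \<open>The spectral width \<open>1\<close> already admits no nonzero function.\<close>

lemma not_majorant: "\<not> Beurling_Malliavin_majorant (\<lambda>x. exp (- \<Omega> x))"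
proof
  assume "Beurling_Malliavin_majorant (\<lambda>x. exp (- \<Omega> x))"
  then obtain f where f: "L2_fun f" "\<not> (AE x in lborel. f x = 0)"
    "AE x in lborel. cmod (f x) \<le> exp (- \<Omega> x)" "spec f \<subseteq> {0..1}"
    unfolding Beurling_Malliavin_majorant_def by (meson zero_less_one)
  obtain g C where g: "g holomorphic_on UNIV" "0 < C"
    "\<And>z. cmod (g z) \<le> C * exp (max 0 (- Im z))"
    "\<And>x. cmod (g (of_real x)) \<le> exp (- \<Omega> x)" "\<exists>x. g (of_real x) \<noteq> 0"
  proof (rule bandlimited_entire_extension[OF f(1,3,4,2)])
    show "continuous_on UNIV (\<lambda>x. exp (- \<Omega> x))" by (intro continuous_intros \<Omega>_continuous)
  qed (auto simp: \<Omega>_nonneg)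
  define C' where "C' = max 1 C"
  have C': "1 \<le> C'" by (simp add: C'_def)
  have g3: "cmod (g z) \<le> C' * exp (max 0 (- Im z))" for z
  proof -
    have "C * exp (max 0 (- Im z)) \<le> C' * exp (max 0 (- Im z))"
      by (intro mult_right_mono) (auto simp: C'_def)
    then show ?thesis using g(3)[of z] by linarith
  qed
  obtain n0 where n0: "\<And>n x. n0 \<le> n \<Longrightarrow> 2 ^ n \<le> x \<Longrightarrow> x \<le> 2 ^ (n + 1) \<Longrightarrow>
    cmod (g (of_real x)) \<le> C' * exp (- (2 ^ n / (real n + 1)))"
    using decay_on_dyadic_blocks[OF g(1) C' g3 g(4)] by blast
  have zero: "g z = 0" if "0 < Im z" for z
  proof (rule eq_0_of_log_integral_diverges[where g = g and ?z0.0 = z and D = "\<lambda>n. 2 ^ n / (real n + 1)" and C = C' and ?n0.0 = n0])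
    show "cmod (g z) \<le> C'" if "0 \<le> Im z" for z using g3[of z] that by simp
    show "2 ^ n / (real n + 1) \<le> 2 ^ n" for n by (simp add: divide_le_eq)
    show "\<not> summable (\<lambda>n. 2 ^ n / (real n + 1) / 2 ^ n)"
    proof
      assume "summable (\<lambda>n. 2 ^ n / (real n + 1) / 2 ^ n)"
      then have "summable (\<lambda>n. inverse (real (Suc n)))" by (simp add: inverse_eq_divide add.commute)
      then have "summable (\<lambda>n. inverse (real n))" by (subst (asm) summable_Suc_iff)
      then show False using not_summable_harmonic[where 'a = real] by blast
    qed
  qed (use g n0 C' that in auto)
  have "g (of_real x) = 0" for x
  proof -
    have "continuous_on UNIV g" using g(1) by (rule holomorphic_on_imp_continuous_on)
    then have "isCont g (of_real x)" by (simp add: continuous_on_eq_continuous_at)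
    moreover have "(\<lambda>k. of_real x + \<i> * of_real (1 / real (Suc k))) \<longlonglongrightarrow> of_real x + \<i> * of_real 0"
      by (intro tendsto_intros LIMSEQ_Suc lim_1_over_n)
    ultimately have "(\<lambda>k. g (of_real x + \<i> * of_real (1 / real (Suc k)))) \<longlonglongrightarrow> g (of_real x)"
      by (intro isCont_tendsto_compose[of _ g]) auto
    moreover have "g (of_real x + \<i> * of_real (1 / real (Suc k))) = 0" for k by (rule zero) simp
    ultimately show ?thesis by (simp add: LIMSEQ_const_iff)
  qed
  with g(5) show False by blast
qed

end

theorem theorem2:
  fixes \<beta> :: real
  assumes "0 < \<beta>" and "\<beta> < 1"
  shows "\<exists>\<omega> :: real \<Rightarrow> real.
    (\<forall>x. 0 < \<omega> x \<and> \<omega> x \<le> 1) \<and>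
    (\<forall>a b. a \<le> b \<longrightarrow> abs_continuous_on_interval (neg_log \<omega>) a b) \<and>
    integrable (density lborel (\<lambda>x. ennreal (1 / (1 + x\<^sup>2)))) (neg_log \<omega>) \<and>
    (\<exists>\<kappa> :: int \<Rightarrow> real.
       (\<forall>j. least_holder_const \<beta> (neg_log \<omega>) (J j) (\<kappa> j)) \<and>
       asymp_one (\<lambda>j. 2 powi (- \<bar>j\<bar>) * \<kappa> j powr (1 / (1 - \<beta>)))) \<and>
    \<not> Beurling_Malliavin_majorant \<omega>"
proof -
  \<comment> \<open>The midpoint of the range of admissible exponents.\<close>
  define b where "b = (2 / (1 + \<beta>) + 1 / \<beta>) / 2"
  have b1: "2 / (1 + \<beta>) < 1 / \<beta>" "1 < 2 / (1 + \<beta>)" using assms by (auto simp: field_simps)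
  then have b2: "2 / (1 + \<beta>) < b" "b < 1 / \<beta>" by (auto simp: b_def)
  interpret spike_train \<beta> b
  proof
    show "1 < b" using b1 b2 by linarith
    show "b * \<beta> < 1" using b2(2) assms by (simp add: field_simps)
    show "2 < b * (1 + \<beta>)" using b2(1) assms by (simp add: field_simps)
  qed (use assms in auto)
  have eq: "neg_log (\<lambda>x. exp (- \<Omega> x)) = \<Omega>"
    by (rule ext) (simp add: neg_log_def ln_div)
  have [measurable]: "\<Omega> \<in> borel_measurable borel"
    by (rule borel_measurable_continuous_onI[OF \<Omega>_continuous])
  have int: "integrable (density lborel (\<lambda>x. ennreal (1 / (1 + x\<^sup>2)))) \<Omega>"
    using \<Omega>_integrable by (subst integrable_density) (auto intro!: AE_I2)
  have "2 powi (- \<bar>j\<bar>) * steepness (nat \<bar>j\<bar>) powr (1 / (1 - \<beta>)) = 1" for j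
  proof -
    have "steepness (nat \<bar>j\<bar>) powr (1 / (1 - \<beta>)) = 2 ^ nat \<bar>j\<bar>"
      using assms by (simp add: steepness_def powr_powr)
    moreover have "2 powi (- \<bar>j\<bar>) = (1 / 2 ^ nat \<bar>j\<bar> :: real)"
      by (simp add: power_int_def inverse_eq_divide power_one_over)
    ultimately show ?thesis by simp
  qed
  then have asy: "asymp_one (\<lambda>j. 2 powi (- \<bar>j\<bar>) * steepness (nat \<bar>j\<bar>) powr (1 / (1 - \<beta>)))"
    unfolding asymp_one_def by (intro exI[of _ 1]) simp
  have "\<exists>\<kappa>. (\<forall>j. least_holder_const \<beta> \<Omega> (J j) (\<kappa> j)) \<and>
       asymp_one (\<lambda>j. 2 powi (- \<bar>j\<bar>) * \<kappa> j powr (1 / (1 - \<beta>)))"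
    using \<Omega>_least_holder_const asy by (intro exI[of _ "\<lambda>j. steepness (nat \<bar>j\<bar>)"]) blast
  then show ?thesis
    by (intro exI[of _ "\<lambda>x. exp (- \<Omega> x)"], unfold eq)
       (use \<Omega>_nonneg \<Omega>_abs_continuous int not_majorant in auto)
qed

end
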